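(* Consider the closed-loop system $\dot{\mathbf{x}}=\mathbf{P}(\mathbf{x})\mathbf{u}(\mathbf{x})$ on $\mathbb{S}^n$, $n\ge2$, with conic constraints $\mathcal{U}_1,\dots,\mathcal{U}_m$, free space $\mathcal{M}_0=\mathbb{S}^n\setminus\mathcal{U}^\circ$, target $\mathbf{x}_d\in\mathcal{M}_0^\circ$ and the negative-gradient feedback law $\mathbf{u}(\mathbf{x})=-\nabla_{\mathbf{x}}W(\mathbf{x})$ described in the context. Assume that there is $\delta\in(0,\frac{\pi}{2}]$ such that $\max_{\mathbf{a}\in\mathcal{U}_i,\,\mathbf{b}\in\mathcal{U}_j}\mathbf{a}^\top\mathbf{b}\le\cos(2\delta)$ for all $i,j\in\mathbb{I}$, $i\neq j$ (this is the $\delta$ used in the choice of $\epsilon$). Then: 1. The set $\mathcal{M}_0$ is forward invariant: if $\mathbf{x}(0)\in\mathcal{M}_0$, then $\mathbf{x}(t)\in\mathcal{M}_0$ for all $t\ge0$. 2. The target point $\mathbf{x}_d$ is almost globally asymptotically stable over $\mathcal{M}_0$, i.e., $\mathbf{x}_d$ is stable and is attractive from all initial conditions in $\mathcal{M}_0$ except a set of zero Lebesgue measure (on $\mathbb{S}^n$).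
   Context: **Sphere.** $\mathbb{S}^n=\{\mathbf{x}\in\mathbb{R}^{n+1}:\|\mathbf{x}\|=1\}$, $n\ge2$; $\mathbf{P}(\mathbf{x})=\mathbf{I}_{n+1}-\mathbf{x}\mathbf{x}^\top$. Interiors $(\cdot)^\circ$ and boundaries $\partial(\cdot)$ are taken in $\mathbb{S}^n$. **Separation.** $d_s(\mathbf{x},\mathbf{a})=1-\mathbf{x}^\top\mathbf{a}$ for $\mathbf{x},\mathbf{a}\in\mathbb{S}^n$; $d_s(\mathbf{x},\mathcal{A})=\inf_{\mathbf{a}\in\mathcal{A}}(1-\mathbf{x}^\top\mathbf{a})$. For $p>0$, $\mathcal{D}_p(\mathcal{A})=\{\mathbf{x}\in\mathbb{S}^n:d_s(\mathbf{x},\mathcal{A})\le p\}$ and $\mathcal{N}_p(\mathcal{A})=\mathcal{D}_p(\mathcal{A})\setminus\mathcal{A}^\circ$. **Setting.** $\mathbb{I}=\{1,\dots,m\}$, $m\in\mathbb{N}$. For each $i\in\mathbb{I}$, $\mathcal{U}_i=\{\mathbf{x}\in\mathbb{S}^n:\mathbf{x}^\top\mathbf{g}_i\ge\cos(\xi_i)\}$ with $\mathbf{g}_i\in\mathbb{S}^n\setminus\{\mathbf{x}_d\}$ and $\xi_i\in(0,\pi)$; $\mathcal{U}=\bigcup_{i\in\mathbb{I}}\mathcal{U}_i$; $\mathcal{M}_0=\mathbb{S}^n\setminus\mathcal{U}^\circ$; the target satisfies $\mathbf{x}_d\in\mathcal{M}_0^\circ$. Fix $\bar\epsilon>0$ with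 $\mathbf{x}_d\notin\mathcal{N}_{\bar\epsilon}(\mathcal{U})$ and $\epsilon\in(0,\min\{\bar\epsilon,1-\cos\delta\})$ (so the sets $\mathcal{D}_\epsilon(\mathcal{U}_i)$ are pairwise disjoint). **Functions $h_i$.** Let $\underline{\Delta}_i=1-\cos(\xi_i)$ and $\overline{\Delta}_i=1-\cos(\xi_i+\arccos(1-\epsilon))$. For each $i$, $h_i:[\underline{\Delta}_i,\overline{\Delta}_i]\to[0,1]$ is a strictly increasing function, real analytic over $[\underline{\Delta}_i,\overline{\Delta}_i]$, with $h_i(\underline{\Delta}_i)=0$, $h_i(\overline{\Delta}_i)=1$, $h_i'(\overline{\Delta}_i)=h_i''(\overline{\Delta}_i)=0$, and $h_i'(p)>0$ for all $p\in[\underline{\Delta}_i,\overline{\Delta}_i)$. **Function $W$ and control.** With $k_1>0$, for $\mathbf{x}\in\mathcal{M}_0$, $$W(\mathbf{x})=\frac{k_1d_s(\mathbf{x},\mathbf{x}_d)}{d_s(\mathbf{x},\mathbf{x}_d)+\beta(\mathbf{x})},\qquad \beta(\mathbf{x})=\begin{cases}h_i(d_s(\mathbf{x},\mathbf{g}_i)),&\mathbf{x}\in\mathcal{N}_\epsilon(\mathcal{U}_i),\\1,&\mathbf{x}\notin\mathcal{N}_\epsilon(\mathcal{U}).\end{cases}$$ The gradient $\nabla_{\mathbf{x}}W$ is the Euclidean gradient in $\mathbb{R}^{n+1}$ of this expression (with $d_s(\mathbf{x},\mathbf{a})=1-\mathbf{x}^\top\mathbf{a}$), so that explicitly $$\mathbf{u}(\mathbf{x})=-\nabla_{\mathbf{x}}W(\mathbf{x})=\begin{cases}\dfrac{k_1\left(h_i(d_s(\mathbf{x},\mathbf{g}_i))\mathbf{x}_d-h_i'(d_s(\mathbf{x},\mathbf{g}_i))d_s(\mathbf{x},\mathbf{x}_d)\mathbf{g}_i\right)}{(h_i(d_s(\mathbf{x},\mathbf{g}_i))+d_s(\mathbf{x},\mathbf{x}_d))^2},&\mathbf{x}\in\mathcal{N}_\epsilon(\mathcal{U}_i),\\[2mm]\dfrac{k_1}{(1+d_s(\mathbf{x},\mathbf{x}_d))^2}\mathbf{x}_d,&\mathbf{x}\notin\mathcal{N}_\epsilon(\mathcal{U}).\end{cases}$$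 *)

theory Defs
  imports "HOL-Analysis.Analysis"
begin

text \<open>
  The sphere S^n is \<open>sphere 0 1\<close> in a Euclidean space of dimension n + 1.
\<close>

definition tangent_proj :: "'a::euclidean_space \<Rightarrow> 'a \<Rightarrow> 'a" where
  "tangent_proj x v = v - (x \<bullet> v) *\<^sub>R x"

definition ds :: "'a::euclidean_space \<Rightarrow> 'a \<Rightarrow> real" where
  "ds x a = 1 - x \<bullet> a"

text \<open>
  Only meaningful for nonempty \<open>A\<close>, as the infimum of the empty set of reals is unspecified.
\<close>

definition ds_set :: "'a::euclidean_space \<Rightarrow> 'a set \<Rightarrow> real" where
  "ds_set x A = (INF a\<in>A. ds x a)"

definition sphere_interior :: "'a::euclidean_space set \<Rightarrow> 'a set" where
  "sphere_interior A = top_of_set (sphere 0 1) interior_of A"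

definition dilation :: "real \<Rightarrow> 'a::euclidean_space set \<Rightarrow> 'a set" where
  "dilation p A = {x \<in> sphere 0 1. ds_set x A \<le> p}"

definition nbhd :: "real \<Rightarrow> 'a::euclidean_space set \<Rightarrow> 'a set" where
  "nbhd p A = dilation p A - sphere_interior A"

definition cone_constraint :: "'a::euclidean_space \<Rightarrow> real \<Rightarrow> 'a set" where
  "cone_constraint g \<xi> = {x \<in> sphere 0 1. x \<bullet> g \<ge> cos \<xi>}"

definition unsafe_set :: "nat \<Rightarrow> (nat \<Rightarrow> 'a::euclidean_space) \<Rightarrow> (nat \<Rightarrow> real) \<Rightarrow> 'a set" where
  "unsafe_set m g \<xi> = (\<Union>i\<in>{1..m}. cone_constraint (g i) (\<xi> i))"

definition free_space :: "nat \<Rightarrow> (nat \<Rightarrow> 'a::euclidean_space) \<Rightarrow> (nat \<Rightarrow> real) \<Rightarrow> 'a set" where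
  "free_space m g \<xi> = sphere 0 1 - sphere_interior (unsafe_set m g \<xi>)"

definition h_domain :: "real \<Rightarrow> real \<Rightarrow> real set" where
  "h_domain \<epsilon> \<xi> = {1 - cos \<xi> .. 1 - cos (\<xi> + arccos (1 - \<epsilon>))}"

text \<open>
  Real analyticity on a nondegenerate interval. At an end point contained in the interval the
  expansion is only required on one side; as its radius of convergence is then positive, this
  amounts to analyticity on an open neighbourhood of the interval.
\<close>

definition real_analytic_on :: "(real \<Rightarrow> real) \<Rightarrow> real set \<Rightarrow> bool" where
  "real_analytic_on f S \<longleftrightarrow>
     (\<forall>x\<in>S. \<exists>r>0. \<exists>a :: nat \<Rightarrow> real. \<forall>y\<in>S. \<bar>y - x\<bar> < r \<longrightarrow> (\<lambda>k. a k * (y - x) ^ k) sums f y)"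

text \<open>
  The index is unique whenever the \<open>\<epsilon>\<close>-dilations of the constraints are pairwise disjoint.
\<close>

definition active_index ::
  "nat \<Rightarrow> real \<Rightarrow> (nat \<Rightarrow> 'a::euclidean_space) \<Rightarrow> (nat \<Rightarrow> real) \<Rightarrow> 'a \<Rightarrow> nat" where
  "active_index m \<epsilon> g \<xi> x = (THE i. i \<in> {1..m} \<and> x \<in> nbhd \<epsilon> (cone_constraint (g i) (\<xi> i)))"

definition barrier :: "nat \<Rightarrow> real \<Rightarrow> (nat \<Rightarrow> 'a::euclidean_space) \<Rightarrow> (nat \<Rightarrow> real) \<Rightarrow>
    (nat \<Rightarrow> real \<Rightarrow> real) \<Rightarrow> 'a \<Rightarrow> real" where
  "barrier m \<epsilon> g \<xi> h x =
     (if x \<in> nbhd \<epsilon> (unsafe_set m g \<xi>)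
      then let i = active_index m \<epsilon> g \<xi> x in h i (ds x (g i))
      else 1)"

definition nav_expr :: "real \<Rightarrow> 'a::euclidean_space \<Rightarrow> ('a \<Rightarrow> real) \<Rightarrow> 'a \<Rightarrow> real" where
  "nav_expr k\<^sub>1 xd b x = k\<^sub>1 * ds x xd / (ds x xd + b x)"

definition nav_fun :: "nat \<Rightarrow> real \<Rightarrow> real \<Rightarrow> 'a::euclidean_space \<Rightarrow> (nat \<Rightarrow> 'a) \<Rightarrow> (nat \<Rightarrow> real) \<Rightarrow>
    (nat \<Rightarrow> real \<Rightarrow> real) \<Rightarrow> 'a \<Rightarrow> real" where
  "nav_fun m \<epsilon> k\<^sub>1 xd g \<xi> h = nav_expr k\<^sub>1 xd (barrier m \<epsilon> g \<xi> h)"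

text \<open>
  The negative Euclidean gradient of the expression defining \<open>nav_fun\<close>, where \<open>h' i\<close> stands for the
  derivative of \<open>h i\<close>; see the lemmas \<open>control_eq_neg_gradient_near\<close> and
  \<open>control_eq_neg_gradient_far\<close> below.
\<close>

definition control :: "nat \<Rightarrow> real \<Rightarrow> real \<Rightarrow> 'a::euclidean_space \<Rightarrow> (nat \<Rightarrow> 'a) \<Rightarrow>
    (nat \<Rightarrow> real) \<Rightarrow> (nat \<Rightarrow> real \<Rightarrow> real) \<Rightarrow> (nat \<Rightarrow> real \<Rightarrow> real) \<Rightarrow> 'a \<Rightarrow> 'a" where
  "control m \<epsilon> k\<^sub>1 xd g \<xi> h h' x =
     (if x \<in> nbhd \<epsilon> (unsafe_set m g \<xi>)
      then let i = active_index m \<epsilon> g \<xi> x; p = ds x (g i); d = ds x xd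
           in (k\<^sub>1 / (h i p + d)\<^sup>2) *\<^sub>R (h i p *\<^sub>R xd - (h' i p * d) *\<^sub>R g i)
      else (k\<^sub>1 / (1 + ds x xd)\<^sup>2) *\<^sub>R xd)"

definition closed_loop :: "('a::euclidean_space \<Rightarrow> 'a) \<Rightarrow> 'a \<Rightarrow> 'a" where
  "closed_loop u x = tangent_proj x (u x)"

text \<open>
  The derivative is taken within \<open>J\<close>, hence one-sided at an end point contained in \<open>J\<close>.
\<close>

definition solution_on :: "('a::euclidean_space \<Rightarrow> 'a) \<Rightarrow> real set \<Rightarrow> (real \<Rightarrow> 'a) \<Rightarrow> bool" where
  "solution_on f J x \<longleftrightarrow>
     (\<forall>t\<in>J. x t \<in> sphere 0 1 \<and> (x has_vector_derivative f (x t)) (at t within J))"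

text \<open>
  No solution starting in \<open>M\<close>, whatever its interval of existence, leaves \<open>M\<close>, and from every point
  of \<open>M\<close> there is a solution for all nonnegative times.
\<close>

definition forward_invariant :: "('a::euclidean_space \<Rightarrow> 'a) \<Rightarrow> 'a set \<Rightarrow> bool" where
  "forward_invariant f M \<longleftrightarrow>
     (\<forall>x\<^sub>0\<in>M. (\<exists>x. solution_on f {0..} x \<and> x 0 = x\<^sub>0) \<and>
             (\<forall>T x. solution_on f {0..<T} x \<and> x 0 = x\<^sub>0 \<longrightarrow> (\<forall>t\<in>{0..<T}. x t \<in> M)))"

definition stable_over :: "('a::euclidean_space \<Rightarrow> 'a) \<Rightarrow> 'a set \<Rightarrow> 'a \<Rightarrow> bool" where
  "stable_over f M p \<longleftrightarrow>
     (\<forall>e>0. \<exists>d>0. \<forall>x. solution_on f {0..} x \<and> x 0 \<in> M \<and> dist (x 0) p < d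
        \<longrightarrow> (\<forall>t\<ge>0. dist (x t) p < e))"

definition attracted_from :: "('a::euclidean_space \<Rightarrow> 'a) \<Rightarrow> 'a \<Rightarrow> 'a \<Rightarrow> bool" where
  "attracted_from f p x\<^sub>0 \<longleftrightarrow>
     (\<exists>x. solution_on f {0..} x \<and> x 0 = x\<^sub>0) \<and>
     (\<forall>x. solution_on f {0..} x \<and> x 0 = x\<^sub>0 \<longrightarrow> (x \<longlongrightarrow> p) at_top)"

text \<open>
  The Lebesgue (surface) measure of a subset \<open>A\<close> of the unit sphere is, up to the factor
  \<open>DIM('a)\<close>, the Lebesgue measure of the truncated cone over \<open>A\<close>.
\<close>

definition sphere_null :: "'a::euclidean_space set \<Rightarrow> bool" where
  "sphere_null A \<longleftrightarrow>
     A \<subseteq> sphere 0 1 \<and> {t *\<^sub>R x | t x. 0 < t \<and> t \<le> 1 \<and> x \<in> A} \<in> null_sets lebesgue"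

definition almost_globally_asymptotically_stable ::
  "('a::euclidean_space \<Rightarrow> 'a) \<Rightarrow> 'a set \<Rightarrow> 'a \<Rightarrow> bool" where
  "almost_globally_asymptotically_stable f M p \<longleftrightarrow>
     stable_over f M p \<and> sphere_null {x\<^sub>0 \<in> M. \<not> attracted_from f p x\<^sub>0}"

text \<open>
  On each branch of its definition, \<open>nav_fun\<close> agrees with an expression defined in the ambient space,
  whose gradient is the negative of the control. In the first lemma the derivative is taken within
  the set where \<open>h i\<close> is evaluated on its domain.
\<close>

lemma control_eq_neg_gradient_near:
  fixes x :: "'a::euclidean_space"
  assumes i_def: "i = active_index m \<epsilon> g \<xi> x"
    and x: "x \<in> nbhd \<epsilon> (unsafe_set m g \<xi>)"
    and h': "(h i has_real_derivative h' i (ds x (g i)))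
               (at (ds x (g i)) within h_domain \<epsilon> (\<xi> i))"
    and nz: "h i (ds x (g i)) + ds x xd \<noteq> 0"
  shows "nav_fun m \<epsilon> k\<^sub>1 xd g \<xi> h x = nav_expr k\<^sub>1 xd (\<lambda>y. h i (ds y (g i))) x"
    and "(nav_expr k\<^sub>1 xd (\<lambda>y. h i (ds y (g i))) has_derivative
            (\<lambda>v. - (control m \<epsilon> k\<^sub>1 xd g \<xi> h h' x \<bullet> v)))
           (at x within {y. ds y (g i) \<in> h_domain \<epsilon> (\<xi> i)})"
proof -
  show "nav_fun m \<epsilon> k\<^sub>1 xd g \<xi> h x = nav_expr k\<^sub>1 xd (\<lambda>y. h i (ds y (g i))) x"
    using x by (simp add: nav_fun_def nav_expr_def barrier_def i_def Let_def)
  let ?S = "{y. ds y (g i) \<in> h_domain \<epsilon> (\<xi> i)}"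
  let ?p = "ds x (g i)" and ?d = "ds x xd"
  have D: "((\<lambda>y. ds y a) has_derivative (\<lambda>v. - (v \<bullet> a))) (at x within ?S)" for a
    unfolding ds_def by (auto intro!: derivative_eq_intros)
  have "(h i has_derivative (*) (h' i ?p)) (at ?p within (\<lambda>y. ds y (g i)) ` ?S)"
    using h' unfolding has_field_derivative_def by (rule has_derivative_subset) auto
  from has_derivative_in_compose[OF D this]
  have H: "((\<lambda>y. h i (ds y (g i))) has_derivative (\<lambda>v. h' i ?p * - (v \<bullet> g i))) (at x within ?S)" .
  have nz': "?d + h i ?p \<noteq> 0"
    using nz by (simp add: add.commute)
  have "((\<lambda>y. k\<^sub>1 * ds y xd / (ds y xd + h i (ds y (g i)))) has_derivative
     (\<lambda>v. (k\<^sub>1 * - (v \<bullet> xd) * (?d + h i ?p) - k\<^sub>1 * ?d * (- (v \<bullet> xd) + h' i ?p * - (v \<bullet> g i)))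
           / ((?d + h i ?p) * (?d + h i ?p)))) (at x within ?S)"
    by (rule has_derivative_divide'[OF has_derivative_mult_right[OF D]
          has_derivative_add[OF D H] nz'])
  moreover have
    "(k\<^sub>1 * - (v \<bullet> xd) * (?d + h i ?p) - k\<^sub>1 * ?d * (- (v \<bullet> xd) + h' i ?p * - (v \<bullet> g i)))
           / ((?d + h i ?p) * (?d + h i ?p)) = - (control m \<epsilon> k\<^sub>1 xd g \<xi> h h' x \<bullet> v)" for v
  proof -
    have "control m \<epsilon> k\<^sub>1 xd g \<xi> h h' x \<bullet> v
        = k\<^sub>1 * (h i ?p * (v \<bullet> xd) - h' i ?p * ?d * (v \<bullet> g i)) / ((?d + h i ?p) * (?d + h i ?p))"
      using x by (simp add: control_def i_def Let_def inner_diff_right inner_commute[of _ v]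
          power2_eq_square add.commute)
    moreover have
      "k\<^sub>1 * - (v \<bullet> xd) * (?d + h i ?p) - k\<^sub>1 * ?d * (- (v \<bullet> xd) + h' i ?p * - (v \<bullet> g i))
        = - (k\<^sub>1 * (h i ?p * (v \<bullet> xd) - h' i ?p * ?d * (v \<bullet> g i)))"
      by (simp add: algebra_simps)
    ultimately show ?thesis
      by simp
  qed
  ultimately show "(nav_expr k\<^sub>1 xd (\<lambda>y. h i (ds y (g i))) has_derivative
            (\<lambda>v. - (control m \<epsilon> k\<^sub>1 xd g \<xi> h h' x \<bullet> v))) (at x within ?S)"
    unfolding nav_expr_def by simp
qed

lemma control_eq_neg_gradient_far:
  fixes x :: "'a::euclidean_space"
  assumes x: "x \<notin> nbhd \<epsilon> (unsafe_set m g \<xi>)" and nz: "1 + ds x xd \<noteq> 0"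
  shows "nav_fun m \<epsilon> k\<^sub>1 xd g \<xi> h x = nav_expr k\<^sub>1 xd (\<lambda>_. 1) x"
    and "(nav_expr k\<^sub>1 xd (\<lambda>_. 1) has_derivative (\<lambda>v. - (control m \<epsilon> k\<^sub>1 xd g \<xi> h h' x \<bullet> v))) (at x)"
proof -
  show "nav_fun m \<epsilon> k\<^sub>1 xd g \<xi> h x = nav_expr k\<^sub>1 xd (\<lambda>_. 1) x"
    using x by (simp add: nav_fun_def nav_expr_def barrier_def)
  let ?d = "ds x xd"
  have D: "((\<lambda>y. ds y xd) has_derivative (\<lambda>v. - (v \<bullet> xd))) (at x)"
    unfolding ds_def by (auto intro!: derivative_eq_intros)
  have nz': "?d + 1 \<noteq> 0"
    using nz by (simp add: add.commute)
  have "((\<lambda>y. k\<^sub>1 * ds y xd / (ds y xd + 1)) has_derivative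
     (\<lambda>v. (k\<^sub>1 * - (v \<bullet> xd) * (?d + 1) - k\<^sub>1 * ?d * (- (v \<bullet> xd) + 0))
           / ((?d + 1) * (?d + 1)))) (at x)"
    by (rule has_derivative_divide'[OF has_derivative_mult_right[OF D]
          has_derivative_add[OF D has_derivative_const] nz'])
  moreover have "(k\<^sub>1 * - (v \<bullet> xd) * (?d + 1) - k\<^sub>1 * ?d * (- (v \<bullet> xd) + 0))
           / ((?d + 1) * (?d + 1)) = - (control m \<epsilon> k\<^sub>1 xd g \<xi> h h' x \<bullet> v)" for v
  proof -
    have "control m \<epsilon> k\<^sub>1 xd g \<xi> h h' x \<bullet> v = k\<^sub>1 * (v \<bullet> xd) / ((?d + 1) * (?d + 1))"
      using x by (simp add: control_def inner_commute[of _ v] power2_eq_square add.commute)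
    moreover have "k\<^sub>1 * - (v \<bullet> xd) * (?d + 1) - k\<^sub>1 * ?d * (- (v \<bullet> xd) + 0) = - (k\<^sub>1 * (v \<bullet> xd))"
      by (simp add: algebra_simps)
    ultimately show ?thesis
      by simp
  qed
  ultimately show "(nav_expr k\<^sub>1 xd (\<lambda>_. 1) has_derivative
      (\<lambda>v. - (control m \<epsilon> k\<^sub>1 xd g \<xi> h h' x \<bullet> v))) (at x)"
    unfolding nav_expr_def by simp
qed

end

theory Submission
  imports Defs
begin

text \<open>
  On \<open>M\<^sub>0\<close> the field \<open>f\<close> is Lipschitz and is the negative gradient, on the sphere, of the potential
  \<open>W\<close>. It points strictly into \<open>M\<^sub>0\<close> on the boundary, whence forward invariance. Since \<open>W\<close> decreases
  at rate \<open>\<bar>f\<bar>\<^sup>2\<close>, the speed tends to \<open>0\<close> along every trajectory. Close to \<open>xd\<close> the sublevel sets of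
  \<open>W\<close> are balls, which gives stability.

  A trajectory that does not converge to \<open>xd\<close> eventually interacts with at most one constraint \<open>g i\<close>,
  so that \<open>u\<close> takes values in the plane spanned by \<open>xd\<close> and \<open>g i\<close>. For \<open>w\<close> orthogonal to that plane,
  \<open>x \<bullet> w\<close> satisfies the linear equation \<open>(x \<bullet> w)' = - (x \<bullet> u) (x \<bullet> w)\<close>, and \<open>x \<bullet> u\<close> is negative at all
  critical points other than \<open>xd\<close>. Hence \<open>x \<bullet> w\<close> grows unless it is zero, whereas it has to vanish in
  the limit: the trajectory reaches the hyperplane orthogonal to \<open>w\<close> in finite time. The points that
  do so by an integer time form a null set, because the flow has a Lipschitz inverse. No stable
  manifold theorem is needed.
\<close>

text \<open>The obstacle is that little is known about the critical points inside a layer around a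
  constraint: they are not shown to be isolated or hyperbolic, nor are trajectories shown to
  converge to one of them. Compactness turns the sign of \<open>x \<bullet> u x\<close> at these
  points into a uniform bound at all points of \<open>M\<close> that are slow and away from
  \<open>xd\<close>, and every trajectory that misses \<open>xd\<close> ends up among those. Outside
  the layers only \<open>xd\<close> and \<open>- xd\<close> can be critical. The layers are
  disjoint, so at most one contains \<open>- xd\<close>; hence the plane is eventually fixed even if
  the trajectory keeps entering and leaving that layer. A normal \<open>w\<close> exists because the
  ambient dimension is at least 3. Analyticity of \<open>h i\<close> provides the continuity of
  \<open>h'' i\<close>, hence a Lipschitz field. Integer times suffice because
  \<open>x \<bullet> w\<close> vanishes from some time on, and they keep the union of null sets
  countable.\<close>

subsection \<open>Lipschitz functions\<close>

text \<open>The constant is hidden so that Lipschitz continuity of composite expressions follows by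
  introduction rules alone.\<close>

definition is_lipschitz_on :: "'a::metric_space set \<Rightarrow> ('a \<Rightarrow> 'b::metric_space) \<Rightarrow> bool" where
  "is_lipschitz_on S f \<longleftrightarrow> (\<exists>L. L-lipschitz_on S f)"

lemma is_lipschitz_on_const [intro]: "is_lipschitz_on S (\<lambda>x. c)"
  unfolding is_lipschitz_on_def by (blast intro: lipschitz_on_constant)

lemma is_lipschitz_on_ident [intro]: "is_lipschitz_on S (\<lambda>x. x)"
  unfolding is_lipschitz_on_def by (blast intro: lipschitz_on_id)

lemma is_lipschitz_on_add:
  fixes f g :: "_ \<Rightarrow> 'b::real_normed_vector"
  assumes "is_lipschitz_on S f" "is_lipschitz_on S g"
  shows "is_lipschitz_on S (\<lambda>x. f x + g x)"
  using assms unfolding is_lipschitz_on_def by (blast intro: lipschitz_on_add)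

lemma is_lipschitz_on_diff:
  fixes f g :: "_ \<Rightarrow> 'b::real_normed_vector"
  assumes "is_lipschitz_on S f" "is_lipschitz_on S g"
  shows "is_lipschitz_on S (\<lambda>x. f x - g x)"
  using assms unfolding is_lipschitz_on_def by (blast intro: lipschitz_on_diff)

lemma is_lipschitz_on_sum:
  fixes f :: "'i \<Rightarrow> _ \<Rightarrow> 'b::real_normed_vector"
  assumes "\<And>i. i \<in> I \<Longrightarrow> is_lipschitz_on S (f i)"
  shows "is_lipschitz_on S (\<lambda>x. \<Sum>i\<in>I. f i x)"
  using assms by (induction I rule: infinite_finite_induct) (auto intro: is_lipschitz_on_add)

lemma is_lipschitz_on_compose:
  assumes "is_lipschitz_on S f" "is_lipschitz_on T g" "f ` S \<subseteq> T"
  shows "is_lipschitz_on S (\<lambda>x. g (f x))"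
proof -
  obtain L M where "L-lipschitz_on S f" "M-lipschitz_on T g"
    using assms is_lipschitz_on_def by metis
  then have "(M * L)-lipschitz_on S (\<lambda>x. g (f x))"
    using assms(3) lipschitz_on_subset by (intro lipschitz_on_compose2) auto
  then show ?thesis
    unfolding is_lipschitz_on_def ..
qed

lemma is_lipschitz_on_subset:
  assumes "is_lipschitz_on T f" "S \<subseteq> T"
  shows "is_lipschitz_on S f"
  using assms unfolding is_lipschitz_on_def by (blast intro: lipschitz_on_subset)

lemma is_lipschitz_on_cong:
  assumes "\<And>x. x \<in> S \<Longrightarrow> f x = g x"
  shows "is_lipschitz_on S f \<longleftrightarrow> is_lipschitz_on S g"
  using assms unfolding is_lipschitz_on_def by (simp cong: lipschitz_on_cong)

lemma is_lipschitz_on_continuous_on: "is_lipschitz_on S f \<Longrightarrow> continuous_on S f"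
  unfolding is_lipschitz_on_def by (blast intro: lipschitz_on_continuous_on)

lemma is_lipschitz_on_bounded:
  fixes f :: "'a::metric_space \<Rightarrow> 'b::metric_space"
  assumes "is_lipschitz_on S f" "bounded S"
  shows "bounded (f ` S)"
proof -
  obtain L where L: "L-lipschitz_on S f"
    using assms is_lipschitz_on_def by auto
  obtain e where e: "\<And>x y. x \<in> S \<Longrightarrow> y \<in> S \<Longrightarrow> dist x y \<le> e"
    using assms(2) bounded_two_points by metis
  have "dist (f x) (f y) \<le> L * e" if "x \<in> S" "y \<in> S" for x y
    using lipschitz_onD[OF L that] mult_left_mono[OF e[OF that] lipschitz_on_nonneg[OF L]]
    by linarith
  then show ?thesis
    by (fastforce simp: bounded_two_points)
qed

text \<open>One product rule for scaling, multiplication and inner products. On a bounded domain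
  both factors are bounded, without which a product of Lipschitz functions need not be
  Lipschitz.\<close>

lemma is_lipschitz_on_bilinear:
  fixes f :: "'x::metric_space \<Rightarrow> 'a::real_normed_vector" and g :: "'x \<Rightarrow> 'b::real_normed_vector"
  assumes p: "bounded_bilinear p" and "is_lipschitz_on S f" "is_lipschitz_on S g" "bounded S"
  shows "is_lipschitz_on S (\<lambda>x. p (f x) (g x))"
proof -
  obtain L M where L: "L-lipschitz_on S f" and M: "M-lipschitz_on S g"
    using assms is_lipschitz_on_def by metis
  obtain B where B: "\<And>x. x \<in> S \<Longrightarrow> norm (f x) \<le> B" and "0 < B"
    using is_lipschitz_on_bounded[OF assms(2,4)] by (auto simp: bounded_pos)
  obtain C where C: "\<And>x. x \<in> S \<Longrightarrow> norm (g x) \<le> C" and "0 < C"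
    using is_lipschitz_on_bounded[OF assms(3,4)] by (auto simp: bounded_pos)
  obtain K where K: "\<And>a b. norm (p a b) \<le> norm a * norm b * K" and "0 \<le> K"
    using bounded_bilinear.nonneg_bounded[OF p] by blast
  have L0: "0 \<le> L" and M0: "0 \<le> M"
    using L M lipschitz_on_nonneg by auto
  have "dist (p (f x) (g x)) (p (f y) (g y)) \<le> (L * C * K + B * M * K) * dist x y"
    if "x \<in> S" "y \<in> S" for x y
  proof -
    have "p (f x) (g x) - p (f y) (g y) = p (f x - f y) (g x) + p (f y) (g x - g y)"
      by (simp add: bounded_bilinear.diff_left[OF p] bounded_bilinear.diff_right[OF p])
    then have "dist (p (f x) (g x)) (p (f y) (g y))
        \<le> norm (p (f x - f y) (g x)) + norm (p (f y) (g x - g y))"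
      by (metis dist_norm norm_triangle_ineq)
    also have "\<dots> \<le> norm (f x - f y) * norm (g x) * K + norm (f y) * norm (g x - g y) * K"
      by (intro add_mono K)
    also have "\<dots> \<le> (L * dist x y) * C * K + B * (M * dist x y) * K"
      using that lipschitz_onD[OF L] lipschitz_onD[OF M] B C L0 M0 \<open>0 < B\<close> \<open>0 < C\<close> \<open>0 \<le> K\<close>
      by (intro add_mono mult_mono) (auto simp: dist_norm)
    finally show ?thesis
      by (simp add: algebra_simps)
  qed
  moreover have "0 \<le> L * C * K + B * M * K"
    using L0 M0 \<open>0 < B\<close> \<open>0 < C\<close> \<open>0 \<le> K\<close> by auto
  ultimately have "(L * C * K + B * M * K)-lipschitz_on S (\<lambda>x. p (f x) (g x))"
    by (intro lipschitz_onI)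
  then show ?thesis
    unfolding is_lipschitz_on_def ..
qed

lemmas is_lipschitz_on_scaleR = is_lipschitz_on_bilinear[OF bounded_bilinear_scaleR]
  and is_lipschitz_on_mult = is_lipschitz_on_bilinear[OF bounded_bilinear_mult]
  and is_lipschitz_on_inner = is_lipschitz_on_bilinear[OF bounded_bilinear_inner]

lemma is_lipschitz_on_inverse:
  fixes f :: "'a::metric_space \<Rightarrow> real"
  assumes "is_lipschitz_on S f" "0 < c" "\<And>x. x \<in> S \<Longrightarrow> c \<le> f x"
  shows "is_lipschitz_on S (\<lambda>x. inverse (f x))"
proof -
  obtain L where L: "L-lipschitz_on S f"
    using assms is_lipschitz_on_def by metis
  have "dist (inverse (f x)) (inverse (f y)) \<le> L / c\<^sup>2 * dist x y" if "x \<in> S" "y \<in> S" for x y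
  proof -
    have pos: "0 < f x" "0 < f y" "c * c \<le> f x * f y"
      using assms that by (force intro!: mult_mono)+
    have "inverse (f x) - inverse (f y) = (f y - f x) / (f x * f y)"
      using pos by (simp add: field_simps)
    then have "dist (inverse (f x)) (inverse (f y)) = dist (f x) (f y) / (f x * f y)"
      using pos by (simp add: dist_real_def abs_mult)
    also have "\<dots> \<le> (L * dist x y) / (c * c)"
      using pos lipschitz_onD[OF L that] \<open>0 < c\<close> by (intro frac_le) (auto intro: order_trans[OF zero_le_dist])
    finally show ?thesis
      by (simp add: power2_eq_square)
  qed
  moreover have "0 \<le> L / c\<^sup>2"
    using lipschitz_on_nonneg[OF L] by simp
  ultimately have "(L / c\<^sup>2)-lipschitz_on S (\<lambda>x. inverse (f x))"
    by (intro lipschitz_onI)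
  then show ?thesis
    unfolding is_lipschitz_on_def ..
qed

text \<open>McShane's extension: every \<open>f s + L * dist x s\<close> is an upper bound for any
  \<open>L\<close>-Lipschitz extension, and the infimum of these bounds is itself
  \<open>L\<close>-Lipschitz.\<close>

lemma lipschitz_on_real_extend:
  fixes f :: "'a::metric_space \<Rightarrow> real"
  assumes f: "L-lipschitz_on S f" and ne: "S \<noteq> {}"
  shows "\<exists>F. L-lipschitz_on UNIV F \<and> (\<forall>x\<in>S. F x = f x)"
proof -
  define F where "F = (\<lambda>x. INF s\<in>S. f s + L * dist x s)"
  have L0: "0 \<le> L"
    using f by (rule lipschitz_on_nonneg)
  obtain s0 where s0: "s0 \<in> S"
    using ne by auto
  have low: "f s0 - L * dist x s0 \<le> f s + L * dist x s" if "s \<in> S" for x s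
  proof -
    have "f s0 - f s \<le> L * dist s0 s"
      using lipschitz_onD[OF f s0 that] by (simp add: dist_real_def)
    moreover have "L * dist s0 s \<le> L * (dist x s0 + dist x s)"
      using L0 by (intro mult_left_mono) (metis dist_commute dist_triangle, auto)
    ultimately show ?thesis
      by (simp add: algebra_simps)
  qed
  have bdd: "bdd_below ((\<lambda>s. f s + L * dist x s) ` S)" for x
    using low by (intro bdd_belowI2) auto
  have one: "F x \<le> F y + L * dist x y" for x y
  proof -
    have "F x - L * dist x y \<le> F y"
      unfolding F_def
    proof (rule cINF_greatest[OF ne])
      fix s assume "s \<in> S"
      have "(INF s\<in>S. f s + L * dist x s) \<le> f s + L * dist x s"
        by (rule cINF_lower[OF bdd \<open>s \<in> S\<close>])
      moreover have "L * dist x s \<le> L * (dist x y + dist y s)"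
        using L0 by (intro mult_left_mono dist_triangle)
      ultimately show "(INF s\<in>S. f s + L * dist x s) - L * dist x y \<le> f s + L * dist y s"
        by (simp add: algebra_simps)
    qed
    then show ?thesis
      by simp
  qed
  have "L-lipschitz_on UNIV F"
  proof (rule lipschitz_onI[OF _ L0])
    fix x y
    show "dist (F x) (F y) \<le> L * dist x y"
      using one[of x y] one[of y x] by (simp add: dist_real_def dist_commute abs_le_iff)
  qed
  moreover have "F x = f x" if "x \<in> S" for x
  proof (rule antisym)
    show "F x \<le> f x"
      unfolding F_def using cINF_lower[OF bdd that, of x] by simp
    show "f x \<le> F x"
      unfolding F_def
    proof (rule cINF_greatest[OF ne])
      fix s assume "s \<in> S"
      then show "f x \<le> f s + L * dist x s"
        using lipschitz_onD[OF f that \<open>s \<in> S\<close>] by (simp add: dist_real_def)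
    qed
  qed
  ultimately show ?thesis
    by blast
qed

lemma is_lipschitz_on_extend:
  fixes f :: "'a::metric_space \<Rightarrow> 'b::euclidean_space"
  assumes "is_lipschitz_on S f" "S \<noteq> {}"
  shows "\<exists>F. is_lipschitz_on UNIV F \<and> (\<forall>x\<in>S. F x = f x)"
proof -
  obtain L where L: "L-lipschitz_on S f"
    using assms is_lipschitz_on_def by metis
  have "L-lipschitz_on S (\<lambda>x. f x \<bullet> b)" if "b \<in> Basis" for b
  proof (rule lipschitz_onI[OF _ lipschitz_on_nonneg[OF L]])
    fix x y assume "x \<in> S" "y \<in> S"
    have "dist (f x \<bullet> b) (f y \<bullet> b) \<le> dist (f x) (f y)"
      using Basis_le_norm[OF that, of "f x - f y"] by (simp add: dist_norm inner_diff_left)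
    then show "dist (f x \<bullet> b) (f y \<bullet> b) \<le> L * dist x y"
      using lipschitz_onD[OF L \<open>x \<in> S\<close> \<open>y \<in> S\<close>] by linarith
  qed
  then have "\<forall>b\<in>Basis. \<exists>F. L-lipschitz_on UNIV F \<and> (\<forall>x\<in>S. F x = f x \<bullet> b)"
    using lipschitz_on_real_extend assms(2) by blast
  then obtain F where F: "\<And>b. b \<in> Basis \<Longrightarrow> L-lipschitz_on UNIV (F b)"
    "\<And>b x. b \<in> Basis \<Longrightarrow> x \<in> S \<Longrightarrow> F b x = f x \<bullet> b"
    by metis
  define G where "G x = (\<Sum>b\<in>Basis. F b x *\<^sub>R b)" for x
  have "is_lipschitz_on UNIV (\<lambda>x. F b x *\<^sub>R b)" if "b \<in> Basis" for b
    using lipschitz_onD[OF F(1)[OF that]] lipschitz_on_nonneg[OF F(1)[OF that]] that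
    unfolding is_lipschitz_on_def
    by (intro exI[of _ L] lipschitz_onI)
      (auto simp: dist_norm simp flip: scaleR_diff_left)
  then have "is_lipschitz_on UNIV G"
    unfolding G_def by (intro is_lipschitz_on_sum)
  moreover have "G x = f x" if "x \<in> S" for x
    using that by (simp add: G_def F(2) euclidean_representation)
  ultimately show ?thesis
    by blast
qed

section \<open>Radial extension from the sphere; null sets of the sphere\<close>

lemma norm_sgn_diff_le:
  fixes v w :: "'a::real_normed_vector"
  shows "norm w * norm (sgn v - sgn w) \<le> 2 * norm (v - w)"
proof (cases "v = 0 \<or> w = 0")
  case True
  then show ?thesis
    by (auto simp: norm_sgn)
next
  case False
  have "norm w * norm (sgn v - sgn w) = norm (norm w *\<^sub>R sgn v - w)"
  proof -
    have "norm w *\<^sub>R sgn v - w = norm w *\<^sub>R (sgn v - sgn w)"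
      using False by (simp add: scaleR_diff_right sgn_div_norm)
    then show ?thesis
      by simp
  qed
  also have "norm w *\<^sub>R sgn v - w = (norm w - norm v) *\<^sub>R sgn v + (v - w)"
    using False by (simp add: scaleR_diff_left sgn_div_norm divide_inverse left_diff_distrib)
  also have "norm \<dots> \<le> \<bar>norm w - norm v\<bar> * norm (sgn v) + norm (v - w)"
    by (metis norm_scaleR norm_triangle_ineq)
  also have "\<dots> \<le> 2 * norm (v - w)"
    using False norm_triangle_ineq3[of v w] by (simp add: norm_sgn)
  finally show ?thesis .
qed

text \<open>The extension of degree one, as \<open>sgn v\<close> is the unit vector along
  \<open>v\<close>. It serves twice: a tangent field on the sphere becomes a field on the whole
  space, and a map of the sphere becomes one that carries rays to rays.\<close>

definition homogeneous_extension :: "('a \<Rightarrow> 'b) \<Rightarrow> 'a::real_normed_vector \<Rightarrow> 'b::real_normed_vector"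
  where "homogeneous_extension f v = norm v *\<^sub>R f (sgn v)"

text \<open>\<open>sgn\<close> is not Lipschitz near the origin; by \<open>norm_sgn_diff_le\<close>
  the factor \<open>norm v\<close> compensates for this.\<close>

lemma is_lipschitz_on_homogeneous_extension:
  fixes f :: "'a::real_normed_vector \<Rightarrow> 'b::real_normed_vector"
  assumes "is_lipschitz_on S f" "bounded S"
  shows "is_lipschitz_on {v. v = 0 \<or> sgn v \<in> S} (homogeneous_extension f)"
proof -
  obtain L where L: "L-lipschitz_on S f"
    using assms is_lipschitz_on_def by metis
  have L0: "0 \<le> L"
    using L by (rule lipschitz_on_nonneg)
  obtain B where B: "\<And>x. x \<in> S \<Longrightarrow> norm (f x) \<le> B" and "0 < B"
    using is_lipschitz_on_bounded[OF assms] by (auto simp: bounded_pos)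
  have zero: "homogeneous_extension f 0 = 0"
    by (simp add: homogeneous_extension_def)
  have z: "norm (homogeneous_extension f v) \<le> (B + 2 * L) * norm v" if "v = 0 \<or> sgn v \<in> S" for v
  proof -
    have "norm (homogeneous_extension f v) \<le> norm v * B"
      using that B by (cases "v = 0") (auto simp: homogeneous_extension_def intro: mult_left_mono)
    also have "\<dots> \<le> (B + 2 * L) * norm v"
      using L0 by (simp add: algebra_simps)
    finally show ?thesis .
  qed
  have main: "norm (homogeneous_extension f v - homogeneous_extension f w) \<le> (B + 2 * L) * norm (v - w)"
    if "sgn v \<in> S" "sgn w \<in> S" for v w
  proof -
    have "homogeneous_extension f v - homogeneous_extension f w
        = (norm v - norm w) *\<^sub>R f (sgn v) + norm w *\<^sub>R (f (sgn v) - f (sgn w))"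
      by (simp add: homogeneous_extension_def algebra_simps)
    then have "norm (homogeneous_extension f v - homogeneous_extension f w)
        \<le> \<bar>norm v - norm w\<bar> * norm (f (sgn v)) + norm w * norm (f (sgn v) - f (sgn w))"
      by (metis norm_scaleR norm_triangle_ineq abs_of_nonneg norm_ge_zero)
    also have "\<dots> \<le> norm (v - w) * B + norm w * (L * norm (sgn v - sgn w))"
      using B[OF that(1)] lipschitz_on_normD[OF L that]
      by (intro add_mono mult_mono norm_triangle_ineq3) auto
    also have "\<dots> \<le> norm (v - w) * B + L * (2 * norm (v - w))"
      using mult_left_mono[OF norm_sgn_diff_le L0, of w v] by (simp add: mult_ac)
    finally show ?thesis
      by (simp add: algebra_simps)
  qed
  have "(B + 2 * L)-lipschitz_on {v. v = 0 \<or> sgn v \<in> S} (homogeneous_extension f)"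
  proof (rule lipschitz_onI)
    fix v w assume "v \<in> {v. v = 0 \<or> sgn v \<in> S}" "w \<in> {v. v = 0 \<or> sgn v \<in> S}"
    then show "dist (homogeneous_extension f v) (homogeneous_extension f w) \<le> (B + 2 * L) * dist v w"
      using main[of v w] z[of v] z[of w]
      by (cases "v = 0"; cases "w = 0") (auto simp: dist_norm zero)
  qed (use L0 \<open>0 < B\<close> in auto)
  then show ?thesis
    unfolding is_lipschitz_on_def ..
qed

lemma negligible_is_lipschitz_on_image:
  fixes f :: "'a::euclidean_space \<Rightarrow> 'a"
  assumes "is_lipschitz_on S f" "negligible S"
  shows "negligible (f ` S)"
proof -
  obtain L where L: "L-lipschitz_on S f"
    using assms is_lipschitz_on_def by metis
  show ?thesis
  proof (rule negligible_locally_Lipschitz_image[OF _ assms(2)])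
    fix x assume "x \<in> S"
    then show "\<exists>T B. open T \<and> x \<in> T \<and> (\<forall>y\<in>S \<inter> T. norm (f y - f x) \<le> B * norm (y - x))"
      using lipschitz_on_normD[OF L] by (intro exI[of _ UNIV] exI[of _ L]) auto
  qed simp
qed

text \<open>The homogeneous extension turns a null cone over \<open>S\<close> into the cone over the image of \<open>S\<close>.\<close>

lemma sphere_null_is_lipschitz_on_image:
  fixes f :: "'a::euclidean_space \<Rightarrow> 'a"
  assumes f: "is_lipschitz_on S f" and S: "S \<subseteq> sphere 0 1" "f ` S \<subseteq> sphere 0 1"
    and N: "negligible N" "\<And>x t. x \<in> S \<Longrightarrow> 0 < t \<Longrightarrow> t *\<^sub>R x \<in> N"
  shows "sphere_null (f ` S)"
proof -
  define K where "K = N \<inter> {v. v = 0 \<or> sgn v \<in> S}"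
  have "negligible K"
    unfolding K_def using N(1) by (rule negligible_Int[OF disjI1])
  moreover have "is_lipschitz_on K (homogeneous_extension f)"
    using is_lipschitz_on_homogeneous_extension[OF f bounded_subset[OF bounded_sphere S(1)]]
    by (rule is_lipschitz_on_subset) (auto simp: K_def)
  ultimately have "negligible (homogeneous_extension f ` K)"
    by (intro negligible_is_lipschitz_on_image)
  moreover have "{t *\<^sub>R x | t x. 0 < t \<and> t \<le> 1 \<and> x \<in> f ` S} \<subseteq> homogeneous_extension f ` K"
  proof clarsimp
    fix t :: real and s assume ts: "0 < t" "t \<le> 1" "s \<in> S"
    have "norm s = 1"
      using S(1) ts by auto
    then have "sgn (t *\<^sub>R s) = s" "norm (t *\<^sub>R s) = t"
      using ts by (auto simp: sgn_div_norm)
    then have "t *\<^sub>R f s = homogeneous_extension f (t *\<^sub>R s)" "t *\<^sub>R s \<in> K"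
      using N(2)[OF ts(3,1)] ts by (auto simp: homogeneous_extension_def K_def)
    then show "t *\<^sub>R f s \<in> homogeneous_extension f ` K"
      by (metis imageI)
  qed
  ultimately show ?thesis
    using S(2) negligible_subset unfolding sphere_null_def by (auto simp: negligible_iff_null_sets[symmetric])
qed

lemma compact_pos_lower_bound:
  fixes f :: "'a::topological_space \<Rightarrow> real"
  assumes "compact K" "continuous_on K f" "\<And>x. x \<in> K \<Longrightarrow> 0 < f x"
  shows "\<exists>r>0. \<forall>x\<in>K. r \<le> f x"
proof (cases "K = {}")
  case False
  then show ?thesis
    using continuous_attains_inf[OF assms(1) _ assms(2)] assms(3) by blast
qed (auto intro: exI[of _ 1])

lemma sphere_null_subset: "sphere_null B \<Longrightarrow> A \<subseteq> B \<Longrightarrow> sphere_null A"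
  unfolding sphere_null_def negligible_iff_null_sets[symmetric]
  by (auto intro: negligible_subset)

lemma sphere_null_UN:
  assumes "countable I" "\<And>i. i \<in> I \<Longrightarrow> sphere_null (A i)"
  shows "sphere_null (\<Union>i\<in>I. A i)"
proof -
  let ?C = "\<lambda>A. {t *\<^sub>R x | t x. 0 < t \<and> t \<le> 1 \<and> x \<in> A}"
  have "?C (\<Union>i\<in>I. A i) = (\<Union>i\<in>I. ?C (A i))"
    by blast
  moreover have "(\<Union>i\<in>I. ?C (A i)) \<in> null_sets lebesgue"
    using assms unfolding sphere_null_def by (intro null_sets_UN') auto
  moreover have "(\<Union>i\<in>I. A i) \<subseteq> sphere 0 1"
    using assms(2) unfolding sphere_null_def by blast
  ultimately show ?thesis
    unfolding sphere_null_def by simp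
qed

subsection \<open>Ordinary differential equations\<close>

text \<open>
  The solution is \<open>x\<^sub>0 + exp (K t) z t\<close>, where \<open>K = 2 L\<close> and \<open>z\<close> is the fixed point of a
  contraction of the bounded continuous functions; the exponential weight makes the Picard operator
  contract on the whole half-line.
\<close>

lemma lipschitz_ode_exists:
  fixes F :: "'a::euclidean_space \<Rightarrow> 'a"
  assumes "is_lipschitz_on UNIV F"
  shows "\<exists>x. x 0 = x\<^sub>0 \<and> (\<forall>t\<ge>0. (x has_vector_derivative F (x t)) (at t within {0..}))"
proof -
  obtain L' where L': "L'-lipschitz_on UNIV F"
    using assms is_lipschitz_on_def by metis
  define L where "L = L' + 1"
  have "0 < L"
    using lipschitz_on_nonneg[OF L'] by (simp add: L_def)
  have L: "norm (F x - F y) \<le> L * norm (x - y)" for x y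
    using lipschitz_on_normD[OF lipschitz_on_le[OF L', of L]] by (simp add: L_def)
  \<comment> \<open>By \<open>bound\<close> below, integrating against the weight gains a factor
    \<open>1 / K\<close>; hence \<open>K = 2 * L\<close> gives the contraction constant
    \<open>1/2\<close>.\<close>
  define K where "K = 2 * L"
  have "0 < K"
    using \<open>0 < L\<close> by (simp add: K_def)
  define G where "G z s = F (x\<^sub>0 + exp (K * s) *\<^sub>R apply_bcontfun z s)" for z :: "real \<Rightarrow>\<^sub>C 'a" and s
  have cont_F: "continuous_on S F" for S
    using is_lipschitz_on_continuous_on[OF assms] continuous_on_subset by blast
  have cont_G: "continuous_on S (G z)" for S z
    unfolding G_def by (intro continuous_on_compose2[OF cont_F[of UNIV]] continuous_intros) auto
  define I where "I z t = integral {0..t} (G z)" for z t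
  have int_G: "G z integrable_on {a..b}" for z a b
    by (intro integrable_continuous_real cont_G)
  have I_deriv: "(I z has_vector_derivative G z t) (at t within {0..T})" if "t \<in> {0..T}" for z t T
    unfolding I_def by (rule integral_has_vector_derivative[OF cont_G that])
  have exp_int: "((\<lambda>s. C * exp (K * s)) has_integral C / K * (exp (K * t) - 1)) {0..t}" if "0 \<le> t" for C t
  proof -
    have "((\<lambda>s. C * exp (K * s)) has_integral (C / K * exp (K * t) - C / K * exp (K * 0))) {0..t}"
      using \<open>0 < K\<close> that
      by (intro fundamental_theorem_of_calculus)
        (auto intro!: derivative_eq_intros simp flip: has_real_derivative_iff_has_vector_derivative)
    then show ?thesis
      by (simp add: algebra_simps)
  qed
  have bound: "norm (integral {0..t} H) \<le> C / K * exp (K * t)"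
    if "0 \<le> t" "0 \<le> C" "H integrable_on {0..t}" "\<And>s. 0 \<le> s \<Longrightarrow> norm (H s) \<le> C * exp (K * s)"
    for H :: "real \<Rightarrow> 'a" and C t
  proof -
    have "norm (integral {0..t} H) \<le> integral {0..t} (\<lambda>s. C * exp (K * s))"
      using that exp_int[OF that(1), of C] by (intro integral_norm_bound_integral) auto
    also have "\<dots> = C / K * (exp (K * t) - 1)"
      using exp_int[OF that(1)] by (rule integral_unique)
    also have "\<dots> \<le> C / K * exp (K * t)"
      using \<open>0 < K\<close> \<open>0 \<le> C\<close> by (intro mult_left_mono) auto
    finally show ?thesis .
  qed
  \<comment> \<open>Bounded continuous functions live on the whole line here; \<open>max 0 t\<close>
    makes the operator constant for negative times.\<close>
  define P where "P z t = exp (- K * max 0 t) *\<^sub>R I z (max 0 t)" for z t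
  have cont_I: "continuous_on {0..} (I z)" for z
    unfolding continuous_on_eq_continuous_within
  proof
    fix t :: real assume "t \<in> {0..}"
    then have "continuous (at t within {0..t+1}) (I z)"
      using has_vector_derivative_continuous[OF I_deriv] by simp
    moreover have "at t within {0..t+1} = at t within {0..}"
      by (rule at_within_nhd[where S="{..<t+1}"]) auto
    ultimately show "continuous (at t within {0..}) (I z)"
      by simp
  qed
  have P_bcontfun: "P z \<in> bcontfun" for z
  proof (rule bcontfun_normI)
    show "continuous_on UNIV (P z)"
      unfolding P_def by (intro continuous_intros continuous_on_compose2[OF cont_I]) auto
    define C where "C = norm (F x\<^sub>0) + L * norm z"
    have "0 \<le> C"
      using \<open>0 < L\<close> by (simp add: C_def)
    have G_le: "norm (G z s) \<le> C * exp (K * s)" if "0 \<le> s" for s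
    proof -
      have "norm (G z s) \<le> norm (F x\<^sub>0) + norm (G z s - F x\<^sub>0)"
        by (rule norm_triangle_sub)
      also have "norm (G z s - F x\<^sub>0) \<le> L * (exp (K * s) * norm z)"
        using L[of "x\<^sub>0 + exp (K * s) *\<^sub>R apply_bcontfun z s" x\<^sub>0] \<open>0 < L\<close> norm_bounded[of z s]
        by (simp add: G_def order_trans mult_left_mono)
      also have "norm (F x\<^sub>0) \<le> norm (F x\<^sub>0) * exp (K * s)"
        using that \<open>0 < K\<close> by (simp add: mult_le_cancel_left1)
      finally show ?thesis
        by (simp add: C_def algebra_simps)
    qed
    show "norm (P z t) \<le> C / K" for t
    proof -
      have "norm (P z t) \<le> exp (- K * max 0 t) * (C / K * exp (K * max 0 t))"
        unfolding P_def I_def norm_scaleR abs_exp_cancel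
        using \<open>0 \<le> C\<close> G_le int_G by (intro mult_left_mono bound) auto
      then show ?thesis
        by (simp add: exp_minus field_simps)
    qed
  qed
  define T where "T z = Bcontfun (P z)" for z
  have T: "apply_bcontfun (T z) = P z" for z
    unfolding T_def using P_bcontfun by (simp add: Bcontfun_inverse)
  have "\<exists>!z. T z = z"
  proof (rule banach_fix_type[of "1/2"])
    show "\<forall>z w. dist (T z) (T w) \<le> 1 / 2 * dist z w"
    proof (intro allI dist_bound)
      fix z w :: "real \<Rightarrow>\<^sub>C 'a" and t :: real
      let ?t = "max 0 t"
      have "norm (G z s - G w s) \<le> L * dist z w * exp (K * s)" for s
      proof -
        have "norm (G z s - G w s)
            \<le> L * norm (exp (K * s) *\<^sub>R (apply_bcontfun z s - apply_bcontfun w s))"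
          unfolding G_def using L by (metis add_diff_cancel_left scaleR_diff_right)
        also have "\<dots> \<le> L * (exp (K * s) * dist z w)"
          using \<open>0 < L\<close> dist_bounded[of z s w] by (simp add: dist_norm)
        finally show ?thesis
          by (simp add: mult_ac)
      qed
      then have "norm (integral {0..?t} (\<lambda>s. G z s - G w s)) \<le> L * dist z w / K * exp (K * ?t)"
        using \<open>0 < L\<close> int_G by (intro bound integrable_diff) auto
      then have "norm (I z ?t - I w ?t) \<le> 1/2 * dist z w * exp (K * ?t)"
        using \<open>0 < L\<close> int_G by (simp add: I_def integral_diff K_def)
      then have "exp (- K * ?t) * norm (I z ?t - I w ?t)
          \<le> exp (- K * ?t) * (1/2 * dist z w * exp (K * ?t))"
        by (intro mult_left_mono) auto
      also have "\<dots> = 1/2 * dist z w"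
        by (simp add: exp_minus field_simps)
      finally show "dist (apply_bcontfun (T z) t) (apply_bcontfun (T w) t) \<le> 1 / 2 * dist z w"
        by (simp add: T P_def dist_norm flip: scaleR_diff_right)
    qed
  qed auto
  then obtain z where z: "T z = z"
    by blast
  define x where "x t = x\<^sub>0 + I z t" for t
  have x: "x t = x\<^sub>0 + exp (K * t) *\<^sub>R apply_bcontfun z t" if "0 \<le> t" for t
    using that T[of z] by (simp add: z P_def x_def exp_minus)
  show ?thesis
  proof (intro exI[of _ x] conjI allI impI)
    show "x 0 = x\<^sub>0"
      by (simp add: x_def I_def)
    fix t :: real assume "0 \<le> t"
    have "(x has_vector_derivative G z t) (at t within {0..t+1})"
      unfolding x_def using I_deriv[of t "t+1" z] \<open>0 \<le> t\<close>
      by (simp add: has_vector_derivative_add_const add.commute[of x\<^sub>0])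
    moreover have "G z t = F (x t)"
      using x[OF \<open>0 \<le> t\<close>] by (simp add: G_def)
    ultimately have "(x has_vector_derivative F (x t)) (at t within {0..t+1})"
      by simp
    moreover have "at t within {0..t+1} = at t within {0..}"
      by (rule at_within_nhd[where S="{..<t+1}"]) auto
    ultimately show "(x has_vector_derivative F (x t)) (at t within {0..})"
      by simp
  qed
qed

lemma has_vector_derivative_inner_right:
  assumes "(x has_vector_derivative v) F"
  shows "((\<lambda>t. x t \<bullet> a) has_real_derivative v \<bullet> a) F"
  using has_derivative_inner_left[OF assms[unfolded has_vector_derivative_def], of a]
  by (simp add: has_field_derivative_def mult.commute[of _ "v \<bullet> a"] fun_eq_iff)

lemma has_vector_derivative_norm_square:
  fixes x :: "real \<Rightarrow> 'a::real_inner"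
  assumes "(x has_vector_derivative v) (at t within S)"
  shows "((\<lambda>t. x t \<bullet> x t) has_real_derivative 2 * (x t \<bullet> v)) (at t within S)"
proof -
  have "(x has_derivative (\<lambda>r. r *\<^sub>R v)) (at t within S)"
    using assms by (simp add: has_vector_derivative_def)
  from has_derivative_inner[OF this this]
  have "((\<lambda>t. x t \<bullet> x t) has_derivative (\<lambda>h. 2 * (x t \<bullet> v) * h)) (at t within S)"
    by (rule back_subst[where P="\<lambda>D. (_ has_derivative D) _"]) (simp add: fun_eq_iff inner_commute)
  then show ?thesis
    by (simp add: has_field_derivative_def)
qed

lemma mvt_on_halfline:
  fixes f :: "real \<Rightarrow> real"
  assumes f: "\<And>t. a \<le> t \<Longrightarrow> (f has_real_derivative f' t) (at t within {a..})"
    and st: "a \<le> s" "s < t"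
  obtains r where "s < r" "r < t" "f t - f s = (t - s) * f' r"
proof -
  have "(f has_derivative (*) (f' r)) (at r within {s..t})" if "s \<le> r" "r \<le> t" for r
    using f[of r] that st has_field_derivative_subset[of f "f' r" r "{a..}" "{s..t}"]
    by (auto simp: has_field_derivative_def)
  then obtain r where "r \<in> {s<..<t}" "f t - f s = f' r * (t - s)"
    using mvt_simple[OF st(2), of f "\<lambda>r. (*) (f' r)"] by auto
  then show ?thesis
    using that by (auto simp: mult.commute)
qed

lemma mono_on_halfline:
  fixes f :: "real \<Rightarrow> real"
  assumes "\<And>t. a \<le> t \<Longrightarrow> (f has_real_derivative f' t) (at t within {a..})"
    and "\<And>t. a \<le> t \<Longrightarrow> 0 \<le> f' t" and "a \<le> s" "s \<le> t"
  shows "f s \<le> f t"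
proof (cases "s = t")
  case False
  with assms(3,4) obtain r where "s < r" "r < t" "f t - f s = (t - s) * f' r"
    using mvt_on_halfline[where f=f and f'=f' and a=a and s=s and t=t] assms(1) by auto
  then show ?thesis
    using mult_nonneg_nonneg[of "t - s" "f' r"] assms(2)[of r] assms(3) by linarith
qed simp

text \<open>Two solutions approach each other at rate at most \<open>L\<close>, which the growing
  weight in \<open>q\<close> compensates. The estimate bounds initial by final positions directly;
  reversing time would not do, since a solution need not remain in \<open>M\<close>
  backwards.\<close>

lemma backward_gronwall:
  fixes f :: "'a::real_inner \<Rightarrow> 'a"
  assumes L: "L-lipschitz_on M f"
    and x: "\<And>t. 0 \<le> t \<Longrightarrow> x t \<in> M \<and> (x has_vector_derivative f (x t)) (at t within {0..})"
    and y: "\<And>t. 0 \<le> t \<Longrightarrow> y t \<in> M \<and> (y has_vector_derivative f (y t)) (at t within {0..})"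
    and "0 \<le> T"
  shows "dist (x 0) (y 0) \<le> exp (L * T) * dist (x T) (y T)"
proof -
  define w where "w t = x t - y t" for t
  define q where "q t = exp (2 * L * t) * (w t \<bullet> w t)" for t
  have "q 0 \<le> q T"
  proof (rule mono_on_halfline[where a = 0 and f = q and s = 0 and t = T and
        f' = "\<lambda>t. exp (2 * L * t) * (2 * L * (w t \<bullet> w t) + 2 * (w t \<bullet> (f (x t) - f (y t))))"])
    fix t :: real assume t: "0 \<le> t"
    have "(w has_vector_derivative f (x t) - f (y t)) (at t within {0..})"
      unfolding w_def[abs_def] using x[OF t] y[OF t] by (auto intro: derivative_intros)
    note dw = has_vector_derivative_norm_square[OF this]
    show "(q has_real_derivative exp (2 * L * t) * (2 * L * (w t \<bullet> w t) + 2 * (w t \<bullet> (f (x t) - f (y t)))))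
        (at t within {0..})"
      unfolding q_def[abs_def] by (rule derivative_eq_intros dw refl)+ (simp add: algebra_simps)
    have "\<bar>w t \<bullet> (f (x t) - f (y t))\<bar> \<le> norm (w t) * norm (f (x t) - f (y t))"
      by (rule Cauchy_Schwarz_ineq2)
    also have "\<dots> \<le> norm (w t) * (L * norm (w t))"
      unfolding w_def using x[OF t] y[OF t] lipschitz_on_normD[OF L] by (intro mult_left_mono) auto
    also have "\<dots> = L * (w t \<bullet> w t)"
      by (simp add: dot_square_norm power2_eq_square)
    finally show "0 \<le> exp (2 * L * t) * (2 * L * (w t \<bullet> w t) + 2 * (w t \<bullet> (f (x t) - f (y t))))"
      by (intro mult_nonneg_nonneg) (auto simp: abs_le_iff)
  qed (use \<open>0 \<le> T\<close> in auto)
  then have "(norm (w 0))\<^sup>2 \<le> (exp (L * T) * norm (w T))\<^sup>2"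
    by (simp add: q_def dot_square_norm power_mult_distrib exp_double[symmetric] mult.assoc)
  then have "norm (w 0) \<le> exp (L * T) * norm (w T)"
    by (rule power2_le_imp_le) auto
  then show ?thesis
    by (simp add: w_def dist_norm)
qed

text \<open>
  Along a gradient flow \<open>\<phi>\<close> is the squared speed, so a nonnegative potential forces it to vanish in
  the limit.
\<close>

lemma decreasing_potential_imp_tendsto_0:
  fixes V \<phi> :: "real \<Rightarrow> real"
  assumes V: "\<And>t. 0 \<le> t \<Longrightarrow> (V has_real_derivative - \<phi> t) (at t within {0..})"
    and V0: "\<And>t. 0 \<le> t \<Longrightarrow> 0 \<le> V t" and \<phi>0: "\<And>t. 0 \<le> t \<Longrightarrow> 0 \<le> \<phi> t"
    and \<phi>: "is_lipschitz_on {0..} \<phi>"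
  shows "(\<phi> \<longlongrightarrow> 0) at_top"
proof -
  obtain L' where L': "L'-lipschitz_on {0..} \<phi>"
    using \<phi> is_lipschitz_on_def by metis
  define L where "L = L' + 1"
  have "0 < L"
    using lipschitz_on_nonneg[OF L'] by (simp add: L_def)
  have L: "\<bar>\<phi> s - \<phi> t\<bar> \<le> L * \<bar>s - t\<bar>" if "0 \<le> s" "0 \<le> t" for s t
    using lipschitz_on_normD[OF lipschitz_on_le[OF L', of L], of s t] that by (simp add: L_def)
  have anti: "V t \<le> V s" if "0 \<le> s" "s \<le> t" for s t
  proof -
    have "- V s \<le> - V t"
    proof (rule mono_on_halfline[where a = 0 and f = "\<lambda>t. - V t" and f' = \<phi>])
      show "((\<lambda>t. - V t) has_real_derivative \<phi> r) (at r within {0..})" if "0 \<le> r" for r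
        using DERIV_minus[OF V[OF that]] by simp
    qed (use \<phi>0 that in auto)
    then show ?thesis
      by simp
  qed
  define v where "v = (INF t\<in>{0..}. V t)"
  have bdd: "bdd_below (V ` {0..})"
    using V0 by (intro bdd_belowI2[of _ 0]) auto
  show ?thesis
  proof (rule tendstoI)
    fix e :: real assume "0 < e"
    \<comment> \<open>On a window of this length \<open>\<phi>\<close> varies by at most
      \<open>e / 2\<close>, while \<open>V\<close> drops by less than
      \<open>\<tau> * (e / 2)\<close> from \<open>T\<close> on; so \<open>\<phi>\<close> is below
      \<open>e / 2\<close> somewhere in each window and below \<open>e\<close> at its start.\<close>
    define \<tau> where "\<tau> = e / (2 * L)"
    have "0 < \<tau>" "L * \<tau> = e / 2"
      using \<open>0 < e\<close> \<open>0 < L\<close> by (auto simp: \<tau>_def field_simps)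
    have "\<exists>T\<in>{0..}. V T < v + \<tau> * (e / 2)"
      using cINF_less_iff[OF _ bdd, of "v + \<tau> * (e / 2)"] \<open>0 < \<tau>\<close> \<open>0 < e\<close> by (auto simp: v_def)
    then obtain T where T: "0 \<le> T" "V T < v + \<tau> * (e / 2)"
      by auto
    have "\<phi> t < e" if "T \<le> t" for t
    proof -
      obtain r where r: "t < r" "r < t + \<tau>" "V (t + \<tau>) - V t = (t + \<tau> - t) * - \<phi> r"
      proof (rule mvt_on_halfline[OF V])
        show "0 \<le> t" "t < t + \<tau>"
          using T(1) \<open>T \<le> t\<close> \<open>0 < \<tau>\<close> by auto
      qed
      have "v \<le> V (t + \<tau>)"
        unfolding v_def using T that \<open>0 < \<tau>\<close> by (intro cINF_lower[OF bdd]) auto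
      moreover have "V (t + \<tau>) = V t - \<tau> * \<phi> r"
        using r by simp
      ultimately have "\<tau> * \<phi> r < \<tau> * (e / 2)"
        using T anti[OF T(1) that] by linarith
      then have "\<phi> r < e / 2"
        using \<open>0 < \<tau>\<close> by simp
      moreover have "\<phi> t - \<phi> r \<le> L * \<tau>"
      proof -
        have "\<bar>\<phi> t - \<phi> r\<bar> \<le> L * \<bar>t - r\<bar>"
          using r(1) T that by (intro L) auto
        also have "\<dots> \<le> L * \<tau>"
          using r \<open>0 < L\<close> by (intro mult_left_mono) auto
        finally show ?thesis
          by linarith
      qed
      ultimately show ?thesis
        using \<open>L * \<tau> = e / 2\<close> by simp
    qed
    then show "\<forall>\<^sub>F t in at_top. dist (\<phi> t) 0 < e"
      using \<phi>0 T by (auto simp: eventually_at_top_linorder intro!: exI[of _ T])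
  qed
qed

subsection \<open>Real analytic functions\<close>

text \<open>Around each point both derivatives agree with the power series differentiated term by
  term. At end points this rests on the uniqueness of derivatives within a nondegenerate closed
  interval.\<close>

lemma real_analytic_on_imp_second_derivative_continuous:
  fixes f :: "real \<Rightarrow> real"
  assumes f: "real_analytic_on f {a..b}" and "a < b"
    and f': "\<And>x. x \<in> {a..b} \<Longrightarrow> (f has_real_derivative f' x) (at x within {a..b})"
    and f'': "\<And>x. x \<in> {a..b} \<Longrightarrow> (f' has_real_derivative f'' x) (at x within {a..b})"
  shows "continuous_on {a..b} f''"
  unfolding continuous_on_eq_continuous_within
proof
  fix x assume x: "x \<in> {a..b}"
  obtain r c where "0 < r" and c: "\<And>y. y \<in> {a..b} \<Longrightarrow> \<bar>y - x\<bar> < r \<Longrightarrow> (\<lambda>k. c k * (y - x) ^ k) sums f y"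
    using f x unfolding real_analytic_on_def by meson
  \<comment> \<open>Convergence at a single point \<open>z\<close> other than \<open>x\<close> gives
    convergence on both sides of \<open>x\<close>, although the expansion is given only within the
    interval.\<close>
  obtain z where z: "z \<in> {a..b}" "\<bar>z - x\<bar> < r" "z \<noteq> x"
  proof (cases "x < b")
    case True
    then show ?thesis
      using x \<open>0 < r\<close> by (intro that[of "x + min (b - x) r / 2"]) (auto simp: min_def field_simps)
  next
    case False
    then show ?thesis
      using x \<open>0 < r\<close> \<open>a < b\<close> by (intro that[of "x - min (x - a) r / 2"]) (auto simp: min_def field_simps)
  qed
  define R where "R = \<bar>z - x\<bar>"
  have "0 < R" "R < r"
    using z by (auto simp: R_def)
  have sm0: "summable (\<lambda>k. c k * w ^ k)" if "norm w < R" for w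
    using powser_inside[OF sums_summable[OF c[OF z(1,2)]]] that by (simp add: R_def)
  have sm1: "summable (\<lambda>k. diffs c k * w ^ k)" if "norm w < R" for w
    using termdiff_converges[OF that sm0] .
  have sm2: "summable (\<lambda>k. diffs (diffs c) k * w ^ k)" if "norm w < R" for w
    using termdiff_converges[OF that sm1] .
  have unique: "D = E" if "(g has_real_derivative D) (at y within {a..b})" "y \<in> {a..b}"
    "(p has_real_derivative E) (at y)" "\<bar>y - x\<bar> < R"
    "\<And>y. y \<in> {a..b} \<Longrightarrow> \<bar>y - x\<bar> < R \<Longrightarrow> g y = p y" for g p D E y
  proof -
    have "(p has_real_derivative D) (at y within {a..b})"
    proof (rule has_field_derivative_transform_within[OF that(1), of "R - \<bar>y - x\<bar>"])
      fix y' assume "y' \<in> {a..b}" "dist y' y < R - \<bar>y - x\<bar>"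
      then show "g y' = p y'"
        by (intro that(5)) (auto simp: dist_real_def)
    qed (use that in auto)
    moreover have "(p has_real_derivative E) (at y within {a..b})"
      using that(3) has_field_derivative_at_within by blast
    ultimately show "D = E"
      using vector_derivative_unique_within_closed_interval[OF \<open>a < b\<close>, of y p D E] that(2)
      by (auto simp: has_real_derivative_iff_has_vector_derivative)
  qed
  have D: "((\<lambda>y. \<Sum>k. d k * (y - x) ^ k) has_real_derivative (\<Sum>k. diffs d k * (y - x) ^ k)) (at y)"
    if "\<And>w. norm w < R \<Longrightarrow> summable (\<lambda>k. d k * w ^ k)" "\<bar>y - x\<bar> < R" for d :: "nat \<Rightarrow> real" and y
  proof -
    have "((\<lambda>w. \<Sum>k. d k * w ^ k) has_real_derivative (\<Sum>k. diffs d k * (y - x) ^ k)) (at (y - x))"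
      using that by (intro termdiffs_strong'[of R]) auto
    moreover have "((\<lambda>y. y - x) has_real_derivative 1) (at y)"
      by (auto intro!: derivative_eq_intros)
    ultimately show ?thesis
      using DERIV_chain2[of "\<lambda>w. \<Sum>k. d k * w ^ k" _ "\<lambda>y. y - x" y 1 UNIV] by simp
  qed
  have f'_eq: "f' y = (\<Sum>k. diffs c k * (y - x) ^ k)" if "y \<in> {a..b}" "\<bar>y - x\<bar> < R" for y
    using that \<open>R < r\<close> c by (intro unique[OF f' _ D[OF sm0]]) (auto simp: sums_iff)
  have f''_eq: "f'' y = (\<Sum>k. diffs (diffs c) k * (y - x) ^ k)" if "y \<in> {a..b}" "\<bar>y - x\<bar> < R" for y
    using that f'_eq by (intro unique[OF f'' _ D[OF sm1]]) auto
  have "isCont (\<lambda>y. \<Sum>k. diffs (diffs c) k * (y - x) ^ k) x"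
    using D[OF sm2, of x] \<open>0 < R\<close> by (intro DERIV_isCont) auto
  then have "continuous (at x within {a..b}) (\<lambda>y. \<Sum>k. diffs (diffs c) k * (y - x) ^ k)"
    by (rule continuous_at_imp_continuous_at_within)
  then show "continuous (at x within {a..b}) f''"
    by (rule continuous_transform_within[OF _ \<open>0 < R\<close> x]) (auto simp: f''_eq dist_real_def)
qed

lemma is_lipschitz_on_vector_derivative:
  fixes f :: "real \<Rightarrow> 'a::real_normed_vector"
  assumes f: "\<And>x. x \<in> S \<Longrightarrow> (f has_vector_derivative f' x) (at x within S)" and "convex S"
    and "bounded (f' ` S)"
  shows "is_lipschitz_on S f"
proof -
  obtain B where "0 < B" and B: "\<And>x. x \<in> S \<Longrightarrow> norm (f' x) \<le> B"
    using assms(3) by (auto simp: bounded_pos)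
  have "onorm (\<lambda>h. h *\<^sub>R f' x) \<le> B" if "x \<in> S" for x
    using B[OF that] by (intro onorm_le) (simp add: mult.commute[of B] mult_left_mono)
  then have "B-lipschitz_on S f"
    using differentiable_bound[OF \<open>convex S\<close> f[unfolded has_vector_derivative_def]] \<open>0 < B\<close>
    by (intro lipschitz_onI) (auto simp: dist_norm)
  then show ?thesis
    unfolding is_lipschitz_on_def ..
qed

subsection \<open>Spherical geometry\<close>

lemma inner_sphere_bounds:
  fixes x y :: "'a::real_inner"
  assumes "norm x = 1" "norm y = 1"
  shows "- 1 \<le> x \<bullet> y" "x \<bullet> y \<le> 1"
  using Cauchy_Schwarz_ineq2[of x y] assms by (auto simp: abs_le_iff)

lemma dist_sphere_eq_ds:
  assumes "norm x = 1" "norm y = 1"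
  shows "(dist x y)\<^sup>2 = 2 * ds x y"
proof -
  have "x \<bullet> x = 1" "y \<bullet> y = 1"
    using assms by (auto simp: norm_eq_1)
  then show ?thesis
    by (simp add: dist_norm power2_norm_eq_inner inner_diff inner_commute[of y x] ds_def)
qed

lemma norm_tangent_proj:
  fixes x v :: "'a::euclidean_space"
  assumes "norm x = 1"
  shows "(norm (tangent_proj x v))\<^sup>2 = v \<bullet> tangent_proj x v"
    and "(norm (tangent_proj x v))\<^sup>2 = (norm v)\<^sup>2 - (x \<bullet> v)\<^sup>2"
    and "x \<bullet> tangent_proj x v = 0"
proof -
  have x: "x \<bullet> x = 1"
    using assms by (simp add: norm_eq_1)
  show "(norm (tangent_proj x v))\<^sup>2 = v \<bullet> tangent_proj x v"
    and "(norm (tangent_proj x v))\<^sup>2 = (norm v)\<^sup>2 - (x \<bullet> v)\<^sup>2"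
    and "x \<bullet> tangent_proj x v = 0"
    unfolding power2_norm_eq_inner tangent_proj_def
    by (simp_all add: x inner_diff inner_commute power2_eq_square)
qed

text \<open>The triangle inequality for angles. After expanding the cosine of the sum it is the
  Cauchy-Schwarz inequality for the tangential parts at \<open>a\<close>, whose norms are
  sines.\<close>

lemma arccos_triangle_sphere:
  fixes x a y :: "'a::euclidean_space"
  assumes "norm x = 1" "norm a = 1" "norm y = 1"
    and "0 \<le> A" "0 \<le> B" "A + B \<le> pi" "cos A \<le> x \<bullet> a" "cos B \<le> a \<bullet> y"
  shows "cos (A + B) \<le> x \<bullet> y"
proof -
  define A' B' where "A' = arccos (x \<bullet> a)" and "B' = arccos (a \<bullet> y)"
  note bd = inner_sphere_bounds[OF assms(1,2)] inner_sphere_bounds[OF assms(2,3)]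
  have cs: "cos A' = x \<bullet> a" "cos B' = a \<bullet> y"
    using bd by (auto simp: A'_def B'_def)
  have r: "0 \<le> A'" "0 \<le> B'" "A' \<le> pi" "B' \<le> pi"
    using bd by (auto simp: A'_def B'_def arccos_lbound arccos_ubound)
  have "A' \<le> A" "B' \<le> B"
    using assms r cos_mono_le_eq[of A A'] cos_mono_le_eq[of B B'] by (auto simp: cs)
  then have "cos (A + B) \<le> cos (A' + B')"
    using r assms by (intro cos_monotone_0_pi_le) auto
  also have "\<dots> = (x \<bullet> a) * (a \<bullet> y) - sin A' * sin B'"
    by (simp add: cos_add cs)
  also have "\<dots> \<le> x \<bullet> y"
  proof -
    have "tangent_proj a x \<bullet> tangent_proj a y = x \<bullet> y - (x \<bullet> a) * (a \<bullet> y)"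
      using assms(2) by (simp add: tangent_proj_def inner_diff inner_commute norm_eq_1)
    moreover have "\<bar>tangent_proj a x \<bullet> tangent_proj a y\<bar>
        \<le> norm (tangent_proj a x) * norm (tangent_proj a y)"
      by (rule Cauchy_Schwarz_ineq2)
    moreover have "norm (tangent_proj a x) = sin A'" "norm (tangent_proj a y) = sin B'"
    proof -
      have "(norm (tangent_proj a x))\<^sup>2 = (sin A')\<^sup>2" "(norm (tangent_proj a y))\<^sup>2 = (sin B')\<^sup>2"
        unfolding sin_squared_eq cs norm_tangent_proj(2)[OF assms(2)]
        by (simp_all add: assms(1,3) inner_commute)
      then show "norm (tangent_proj a x) = sin A'" "norm (tangent_proj a y) = sin B'"
        using power2_eq_imp_eq[OF _ norm_ge_zero sin_ge_zero] r by blast+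
    qed
    ultimately show ?thesis
      by (simp add: abs_le_iff)
  qed
  finally show ?thesis .
qed

lemma sphere_polar:
  fixes x g :: "'a::euclidean_space"
  assumes "norm x = 1" "norm g = 1" "2 \<le> DIM('a)"
  obtains e where "norm e = 1" "e \<bullet> g = 0" "x = cos (arccos (x \<bullet> g)) *\<^sub>R g + sin (arccos (x \<bullet> g)) *\<^sub>R e"
proof -
  let ?p = "tangent_proj g x" and ?\<theta> = "arccos (x \<bullet> g)"
  have bd: "cos ?\<theta> = x \<bullet> g" "0 \<le> ?\<theta>" "?\<theta> \<le> pi"
    using inner_sphere_bounds[OF assms(1,2)] by (auto simp: arccos_lbound arccos_ubound)
  have x: "x = cos ?\<theta> *\<^sub>R g + ?p"
    unfolding bd(1) by (simp add: tangent_proj_def inner_commute)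
  have "(norm ?p)\<^sup>2 = (sin ?\<theta>)\<^sup>2"
    using norm_tangent_proj(2)[OF assms(2), of x] assms(1)
    unfolding sin_squared_eq bd(1) by (simp add: inner_commute)
  then have n: "norm ?p = sin ?\<theta>"
    by (rule power2_eq_imp_eq[OF _ norm_ge_zero sin_ge_zero[OF bd(2,3)]])
  show ?thesis
  proof (cases "?p = 0")
    case True
    obtain y where y: "y \<noteq> 0" "orthogonal g y"
      using orthogonal_to_vector_exists[OF assms(3), of g] by auto
    show ?thesis
    proof (rule that[of "sgn y"])
      show "norm (sgn y) = 1" "sgn y \<bullet> g = 0"
        using y by (auto simp: norm_sgn sgn_div_norm orthogonal_def inner_commute)
      show "x = cos ?\<theta> *\<^sub>R g + sin ?\<theta> *\<^sub>R sgn y"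
        using x n True by simp
    qed
  next
    case False
    show ?thesis
    proof (rule that[of "sgn ?p"])
      show "norm (sgn ?p) = 1"
        using False by (simp add: norm_sgn)
      show "sgn ?p \<bullet> g = 0"
        using norm_tangent_proj(3)[OF assms(2), of x] by (simp add: sgn_div_norm inner_commute)
      have "?p = norm ?p *\<^sub>R sgn ?p"
        using False by (simp add: sgn_div_norm)
      then show "x = cos ?\<theta> *\<^sub>R g + sin ?\<theta> *\<^sub>R sgn ?p"
        using x unfolding n by simp
    qed
  qed
qed

lemma sphere_circle:
  fixes g e :: "'a::euclidean_space"
  assumes "norm g = 1" "norm e = 1" "e \<bullet> g = 0"
  shows "(cos s *\<^sub>R g + sin s *\<^sub>R e) \<bullet> (cos t *\<^sub>R g + sin t *\<^sub>R e) = cos (s - t)"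
    and "(cos s *\<^sub>R g + sin s *\<^sub>R e) \<bullet> g = cos s"
    and "norm (cos s *\<^sub>R g + sin s *\<^sub>R e) = 1"
proof -
  have "g \<bullet> g = 1" "e \<bullet> e = 1" "g \<bullet> e = 0"
    using assms by (auto simp: norm_eq_1 inner_commute)
  then show "(cos s *\<^sub>R g + sin s *\<^sub>R e) \<bullet> (cos t *\<^sub>R g + sin t *\<^sub>R e) = cos (s - t)"
    and "(cos s *\<^sub>R g + sin s *\<^sub>R e) \<bullet> g = cos s"
    and "norm (cos s *\<^sub>R g + sin s *\<^sub>R e) = 1"
    using assms(3) by (simp_all add: inner_add norm_eq_1 cos_diff flip: power2_eq_square)
qed

section \<open>Dilations of spherical caps, and the free space\<close>

lemma dilation_iff:
  fixes A :: "'a::euclidean_space set"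
  assumes "compact A" "A \<noteq> {}"
  shows "x \<in> dilation p A \<longleftrightarrow> norm x = 1 \<and> (\<exists>a\<in>A. 1 - p \<le> x \<bullet> a)"
proof -
  have "continuous_on A (ds x)"
    unfolding ds_def[abs_def] by (intro continuous_intros)
  from continuous_attains_inf[OF assms this] obtain a where a: "a \<in> A" "\<And>b. b \<in> A \<Longrightarrow> ds x a \<le> ds x b"
    by blast
  have "ds_set x A = ds x a"
    unfolding ds_set_def using a by (intro cInf_eq_minimum) auto
  then show ?thesis
    using a by (force simp: dilation_def ds_def)
qed

lemma cone_constraint_compact: "compact (cone_constraint g \<xi>)"
proof -
  have "cone_constraint g \<xi> = sphere 0 1 \<inter> {x. x \<bullet> g \<ge> cos \<xi>}"
    by (auto simp: cone_constraint_def)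
  moreover have "closed {x. x \<bullet> g \<ge> cos \<xi>}"
    by (intro closed_Collect_le continuous_intros)
  ultimately show ?thesis
    by (simp add: compact_Int_closed)
qed

lemma cone_constraint_nonempty: "norm g = 1 \<Longrightarrow> g \<in> cone_constraint g \<xi>"
  by (simp add: cone_constraint_def norm_eq_1)

lemma dilation_cone_constraint_subset:
  assumes "norm g = 1" "0 < \<epsilon>" "\<epsilon> \<le> 1" "0 < \<xi>" "\<xi> + arccos (1 - \<epsilon>) \<le> pi"
    and "x \<in> dilation \<epsilon> (cone_constraint g \<xi>)"
  shows "norm x = 1" "cos (\<xi> + arccos (1 - \<epsilon>)) \<le> x \<bullet> g"
proof -
  obtain a where a: "norm x = 1" "a \<in> cone_constraint g \<xi>" "1 - \<epsilon> \<le> x \<bullet> a"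
    using assms dilation_iff[OF cone_constraint_compact] cone_constraint_nonempty by blast
  then show "norm x = 1"
    by simp
  have "cos (arccos (1 - \<epsilon>) + \<xi>) \<le> x \<bullet> g"
    using a assms by (intro arccos_triangle_sphere[of x a]) (auto simp: cone_constraint_def arccos_lbound)
  then show "cos (\<xi> + arccos (1 - \<epsilon>)) \<le> x \<bullet> g"
    by (simp add: add.commute)
qed

text \<open>The witness lies on the great circle from \<open>g\<close> to \<open>x\<close>, at angle
  at most \<open>\<xi>\<close> from \<open>g\<close>. The hypothesis compares angles rather than
  cosines because \<open>\<xi> + arccos (1 - \<epsilon>)\<close> may exceed \<open>pi\<close> here;
  \<open>cap_angle\<close> uses the lemma to exclude this.\<close>

lemma dilation_cone_constraint_supset:
  fixes x g :: "'a::euclidean_space"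
  assumes "norm g = 1" "0 < \<epsilon>" "\<epsilon> \<le> 1" "0 < \<xi>" "\<xi> < pi" "2 \<le> DIM('a)"
    and "norm x = 1" "arccos (x \<bullet> g) \<le> \<xi> + arccos (1 - \<epsilon>)"
  shows "x \<in> dilation \<epsilon> (cone_constraint g \<xi>)"
proof -
  let ?\<theta> = "arccos (x \<bullet> g)"
  have bd: "0 \<le> ?\<theta>" "?\<theta> \<le> pi"
    using inner_sphere_bounds[OF assms(7,1)] by (auto simp: arccos_lbound arccos_ubound)
  obtain e where e: "norm e = 1" "e \<bullet> g = 0" "x = cos ?\<theta> *\<^sub>R g + sin ?\<theta> *\<^sub>R e"
    using sphere_polar[OF assms(7,1,6)] .
  define \<eta> where "\<eta> = min ?\<theta> \<xi>"
  define a where "a = cos \<eta> *\<^sub>R g + sin \<eta> *\<^sub>R e"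
  note circ = sphere_circle[OF assms(1) e(1,2)]
  have "cos \<xi> \<le> cos \<eta>"
    using bd assms by (intro cos_monotone_0_pi_le) (auto simp: \<eta>_def)
  then have "a \<in> cone_constraint g \<xi>"
    using circ by (simp add: cone_constraint_def a_def)
  moreover have "1 - \<epsilon> \<le> x \<bullet> a"
  proof -
    have "x \<bullet> a = cos (?\<theta> - \<eta>)"
      by (subst e(3)) (simp only: a_def circ)
    moreover have "cos (arccos (1 - \<epsilon>)) \<le> cos (?\<theta> - \<eta>)"
      using assms bd arccos_lbound[of "1 - \<epsilon>"] arccos_ubound[of "1 - \<epsilon>"]
      by (intro cos_monotone_0_pi_le) (auto simp: \<eta>_def)
    ultimately show ?thesis
      using assms by simp
  qed
  ultimately show ?thesis
    using dilation_iff[OF cone_constraint_compact] cone_constraint_nonempty[OF assms(1)] assms(7)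
    by blast
qed

text \<open>The interior of a union can exceed the union of the interiors, for instance along a
  common boundary. Disjointness excludes this: near a boundary point of one cap the others are
  absent, and continuing the great circle away from the centre leaves the cap at once.\<close>

lemma free_space_iff:
  fixes g :: "nat \<Rightarrow> 'a::euclidean_space"
  assumes g: "\<And>i. i \<in> {1..m} \<Longrightarrow> norm (g i) = 1"
    and \<xi>: "\<And>i. i \<in> {1..m} \<Longrightarrow> 0 < \<xi> i \<and> \<xi> i < pi"
    and disj: "\<And>i j. \<lbrakk>i \<in> {1..m}; j \<in> {1..m}; i \<noteq> j\<rbrakk>
        \<Longrightarrow> cone_constraint (g i) (\<xi> i) \<inter> cone_constraint (g j) (\<xi> j) = {}"
    and dim: "2 \<le> DIM('a)"
  shows "x \<in> free_space m g \<xi> \<longleftrightarrow> norm x = 1 \<and> (\<forall>i\<in>{1..m}. x \<bullet> g i \<le> cos (\<xi> i))"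
proof
  assume x: "x \<in> free_space m g \<xi>"
  have "x \<bullet> g i \<le> cos (\<xi> i)" if i: "i \<in> {1..m}" for i
  proof (rule ccontr)
    let ?O = "sphere 0 1 \<inter> {y. cos (\<xi> i) < y \<bullet> g i}"
    assume "\<not> x \<bullet> g i \<le> cos (\<xi> i)"
    then have "x \<in> ?O"
      using x by (auto simp: free_space_def)
    moreover have "openin (top_of_set (sphere 0 1)) ?O"
      by (intro openin_open_Int open_Collect_less continuous_intros)
    moreover have "?O \<subseteq> unsafe_set m g \<xi>"
      using i by (auto simp: unsafe_set_def cone_constraint_def)
    ultimately have "x \<in> sphere_interior (unsafe_set m g \<xi>)"
      unfolding sphere_interior_def interior_of_def by blast
    then show False
      using x by (simp add: free_space_def)
  qed
  then show "norm x = 1 \<and> (\<forall>i\<in>{1..m}. x \<bullet> g i \<le> cos (\<xi> i))"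
    using x by (auto simp: free_space_def)
next
  assume x: "norm x = 1 \<and> (\<forall>i\<in>{1..m}. x \<bullet> g i \<le> cos (\<xi> i))"
  have "x \<notin> sphere_interior (unsafe_set m g \<xi>)"
  proof
    assume "x \<in> sphere_interior (unsafe_set m g \<xi>)"
    then obtain T where T: "openin (top_of_set (sphere 0 1)) T" "x \<in> T" "T \<subseteq> unsafe_set m g \<xi>"
      unfolding sphere_interior_def interior_of_def by blast
    then obtain O' where O': "open O'" "T = sphere 0 1 \<inter> O'"
      by (auto simp: openin_open)
    obtain i where i: "i \<in> {1..m}" "x \<in> cone_constraint (g i) (\<xi> i)"
      using T unfolding unsafe_set_def by blast
    then have xg: "x \<bullet> g i = cos (\<xi> i)"
      using x by (force simp: cone_constraint_def)
    then have \<theta>: "arccos (x \<bullet> g i) = \<xi> i"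
      using \<xi>[OF i(1)] by (simp add: arccos_cos)
    obtain e where e: "norm e = 1" "e \<bullet> g i = 0" "x = cos (\<xi> i) *\<^sub>R g i + sin (\<xi> i) *\<^sub>R e"
      using sphere_polar[of x "g i"] x g[OF i(1)] dim unfolding \<theta> by metis
    define V where "V = O' \<inter> (\<Inter>j\<in>{1..m}-{i}. {y. y \<bullet> g j < cos (\<xi> j)})"
    have "open V"
      unfolding V_def using O'(1) by (intro open_Int open_INT ballI open_Collect_less continuous_intros) auto
    have "x \<bullet> g j < cos (\<xi> j)" if "j \<in> {1..m} - {i}" for j
      using disj[of i j] that i x by (force simp: cone_constraint_def)
    then have "x \<in> V"
      using T O' by (auto simp: V_def)
    define \<gamma> where "\<gamma> s = cos (\<xi> i + s) *\<^sub>R g i + sin (\<xi> i + s) *\<^sub>R e" for s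
    have "isCont \<gamma> 0"
      unfolding \<gamma>_def[abs_def] by (intro continuous_intros)
    moreover have "\<gamma> 0 = x"
      using e by (simp add: \<gamma>_def)
    ultimately have "(\<gamma> \<longlongrightarrow> x) (at 0)"
      by (simp add: isCont_def)
    then have "\<forall>\<^sub>F s in at 0. \<gamma> s \<in> V"
      using \<open>open V\<close> \<open>x \<in> V\<close> by (rule topological_tendstoD)
    then have "\<forall>\<^sub>F s in at_right 0. \<gamma> s \<in> V"
      by (rule filter_leD[OF at_le, rotated]) auto
    moreover have "\<forall>\<^sub>F s in at_right 0. s \<in> {0<..<pi - \<xi> i}"
      using \<xi>[OF i(1)] by (intro eventually_at_right_real) auto
    ultimately have "\<forall>\<^sub>F s in at_right 0. \<gamma> s \<in> V \<and> s \<in> {0<..<pi - \<xi> i}"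
      by (rule eventually_conj)
    then obtain s where s: "\<gamma> s \<in> V" "0 < s" "s < pi - \<xi> i"
      using eventually_happens'[OF trivial_limit_at_right_real] by force
    note circ = sphere_circle[OF g[OF i(1)] e(1,2), of "\<xi> i + s"]
    have "cos (\<xi> i + s) < cos (\<xi> i)"
      using s \<xi>[OF i(1)] by (intro cos_monotone_0_pi) auto
    then have "\<gamma> s \<bullet> g i < cos (\<xi> i)"
      by (simp only: \<gamma>_def circ)
    then have "\<gamma> s \<notin> unsafe_set m g \<xi>"
      using s(1) by (auto simp: unsafe_set_def cone_constraint_def V_def not_le)
    moreover have "\<gamma> s \<in> T"
      using s(1) circ(3) by (simp add: O'(2) V_def \<gamma>_def)
    ultimately show False
      using T(3) by blast
  qed
  then show "x \<in> free_space m g \<xi>"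
    using x by (simp add: free_space_def)
qed

text \<open>Geometrically: a point of the arc from \<open>g\<close> to \<open>z\<close> is no farther from \<open>g\<close> than \<open>z\<close> is.\<close>

lemma inner_nonneg_combination_ge:
  fixes z g y :: "'a::real_inner"
  assumes "norm z = 1" "norm g = 1" "norm y = 1" "0 \<le> a" "0 \<le> b" "y = a *\<^sub>R z + b *\<^sub>R g"
  shows "z \<bullet> g \<le> y \<bullet> g"
proof -
  define s where "s = z \<bullet> g"
  have s: "-1 \<le> s" "s \<le> 1"
    using inner_sphere_bounds[OF assms(1,2)] by (auto simp: s_def)
  have n: "z \<bullet> z = 1" "g \<bullet> g = 1" "y \<bullet> y = 1"
    using assms(1-3) by (auto simp: norm_eq_1)
  have yg: "y \<bullet> g = a * s + b"
    by (simp add: assms(6) inner_add n s_def)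
  have one: "a\<^sup>2 + b\<^sup>2 + 2 * a * b * s = 1"
    using n(3) unfolding assms(6)
    by (simp add: inner_add n inner_commute[of g z] power2_eq_square algebra_simps flip: s_def)
  have "s \<le> a * s + b"
  proof (cases "a \<le> 1")
    case True
    show ?thesis
    proof (cases "s \<le> 0")
      case True
      have "s \<le> a * s"
        using True \<open>a \<le> 1\<close> by (metis mult_right_mono_neg mult_1)
      then show ?thesis
        using assms(5) by simp
    next
      case False
      have "2 * a * b * s \<le> 2 * a * b * 1"
        using s assms by (intro mult_left_mono) auto
      then have "1\<^sup>2 \<le> (a + b)\<^sup>2"
        using one by (simp add: power2_eq_square algebra_simps)
      then have "1 \<le> a + b"
        using assms by (intro power2_le_imp_le[of 1 "a + b"]) auto
      moreover have "(1 - a) * s \<le> (1 - a) * 1"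
        using s \<open>a \<le> 1\<close> by (intro mult_left_mono) auto
      ultimately show ?thesis
        by (simp add: algebra_simps)
    qed
  next
    case False
    show ?thesis
    proof (cases "0 \<le> s")
      case True
      have "1 * s \<le> a * s"
        using True False by (intro mult_right_mono) auto
      then show ?thesis
        using assms(5) by simp
    next
      case neg: False
      have "s\<^sup>2 \<le> 1"
        using s by (simp add: abs_square_le_1 abs_le_iff)
      \<comment> \<open>For unit vectors these are squared distances from the axis of
        \<open>g\<close>. As \<open>a > 1\<close>, \<open>y\<close> is at least as far from the axis
        as \<open>z\<close>, so \<open>y \<bullet> g\<close> cannot be below the negative
        \<open>s\<close>.\<close>
      have "1 - (a * s + b)\<^sup>2 = a\<^sup>2 * (1 - s\<^sup>2)"
        using one by (simp add: power2_eq_square algebra_simps)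
      moreover have "1 * (1 - s\<^sup>2) \<le> a\<^sup>2 * (1 - s\<^sup>2)"
        using False \<open>s\<^sup>2 \<le> 1\<close> by (intro mult_right_mono) auto
      ultimately have "(a * s + b)\<^sup>2 \<le> s\<^sup>2"
        by simp
      then have "\<bar>a * s + b\<bar> \<le> \<bar>s\<bar>"
        by (simp add: abs_le_square_iff)
      then show ?thesis
        using neg by (simp add: abs_le_iff abs_if split: if_splits)
    qed
  qed
  then show ?thesis
    by (simp add: yg s_def)
qed

subsection \<open>The closed-loop vector field\<close>

locale conic_navigation =
  fixes m :: nat and g :: "nat \<Rightarrow> 'a::euclidean_space" and xd :: 'a and \<xi> :: "nat \<Rightarrow> real"
    and h h' h'' :: "nat \<Rightarrow> real \<Rightarrow> real" and \<delta> \<epsilon> \<epsilon>bar k\<^sub>1 :: real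
  assumes dim: "3 \<le> DIM('a)"
    and g: "\<And>i. i \<in> {1..m} \<Longrightarrow> g i \<in> sphere 0 1 - {xd}"
    and \<xi>: "\<And>i. i \<in> {1..m} \<Longrightarrow> 0 < \<xi> i \<and> \<xi> i < pi"
    and xd: "xd \<in> sphere_interior (free_space m g \<xi>)"
    and \<delta>: "0 < \<delta>" "\<delta> \<le> pi / 2"
    and separated: "\<And>i j a b. \<lbrakk>i \<in> {1..m}; j \<in> {1..m}; i \<noteq> j;
            a \<in> cone_constraint (g i) (\<xi> i); b \<in> cone_constraint (g j) (\<xi> j)\<rbrakk>
          \<Longrightarrow> a \<bullet> b \<le> cos (2 * \<delta>)"
    and xd_far: "xd \<notin> nbhd \<epsilon>bar (unsafe_set m g \<xi>)"
    and \<epsilon>: "0 < \<epsilon>" "\<epsilon> < min \<epsilon>bar (1 - cos \<delta>)"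
    and h_range: "\<And>i. i \<in> {1..m} \<Longrightarrow> h i \<in> h_domain \<epsilon> (\<xi> i) \<rightarrow> {0..1}"
    and h_mono: "\<And>i. i \<in> {1..m} \<Longrightarrow> strict_mono_on (h_domain \<epsilon> (\<xi> i)) (h i)"
    and h_analytic: "\<And>i. i \<in> {1..m} \<Longrightarrow> real_analytic_on (h i) (h_domain \<epsilon> (\<xi> i))"
    and h': "\<And>i p. \<lbrakk>i \<in> {1..m}; p \<in> h_domain \<epsilon> (\<xi> i)\<rbrakk>
          \<Longrightarrow> (h i has_real_derivative h' i p) (at p within h_domain \<epsilon> (\<xi> i))"
    and h'': "\<And>i p. \<lbrakk>i \<in> {1..m}; p \<in> h_domain \<epsilon> (\<xi> i)\<rbrakk>
          \<Longrightarrow> (h' i has_real_derivative h'' i p) (at p within h_domain \<epsilon> (\<xi> i))"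
    and h_inner: "\<And>i. i \<in> {1..m} \<Longrightarrow> h i (1 - cos (\<xi> i)) = 0"
    and h_outer: "\<And>i. i \<in> {1..m} \<Longrightarrow> h i (1 - cos (\<xi> i + arccos (1 - \<epsilon>))) = 1"
    and h'_outer: "\<And>i. i \<in> {1..m} \<Longrightarrow> h' i (1 - cos (\<xi> i + arccos (1 - \<epsilon>))) = 0"
    and h'_pos: "\<And>i p. \<lbrakk>i \<in> {1..m}; 1 - cos (\<xi> i) \<le> p; p < 1 - cos (\<xi> i + arccos (1 - \<epsilon>))\<rbrakk>
          \<Longrightarrow> h' i p > 0"
    and k\<^sub>1: "k\<^sub>1 > 0"
begin

abbreviation "M \<equiv> free_space m g \<xi>"
abbreviation "c i \<equiv> cos (\<xi> i)"
abbreviation "e i \<equiv> cos (\<xi> i + arccos (1 - \<epsilon>))"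
abbreviation "u \<equiv> control m \<epsilon> k\<^sub>1 xd g \<xi> h h'"
abbreviation "f \<equiv> closed_loop u"

section \<open>Caps, layers and their separation\<close>

lemma norm_g: "i \<in> {1..m} \<Longrightarrow> norm (g i) = 1"
  using g by auto

lemma xd_in_M: "xd \<in> M"
  using xd interior_of_subset unfolding sphere_interior_def by fast

lemma norm_xd: "norm xd = 1"
  using xd_in_M by (simp add: free_space_def)

lemma \<epsilon>_less_1: "\<epsilon> < 1"
  using \<epsilon> \<delta> cos_ge_zero[of \<delta>] by auto

text \<open>This angle is the width of the layers. As it is below \<open>\<delta>\<close>, the
  layers of two constraints at angle at least \<open>2 * \<delta>\<close> cannot meet.\<close>

lemma arccos_\<epsilon>: "0 < arccos (1 - \<epsilon>)" "arccos (1 - \<epsilon>) < \<delta>"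
proof -
  show "0 < arccos (1 - \<epsilon>)"
    using arccos_lt_bounded[of "1 - \<epsilon>"] \<epsilon> \<epsilon>_less_1 by auto
  have "cos \<delta> < cos (arccos (1 - \<epsilon>))"
    using \<epsilon> \<epsilon>_less_1 by simp
  then show "arccos (1 - \<epsilon>) < \<delta>"
    using \<delta> \<epsilon> \<epsilon>_less_1 cos_mono_less_eq[of \<delta> "arccos (1 - \<epsilon>)"]
    by (auto simp: arccos_lbound arccos_ubound)
qed

lemma cones_disjoint:
  assumes "i \<in> {1..m}" "j \<in> {1..m}" "i \<noteq> j"
  shows "cone_constraint (g i) (\<xi> i) \<inter> cone_constraint (g j) (\<xi> j) = {}"
proof (rule ccontr)
  assume "cone_constraint (g i) (\<xi> i) \<inter> cone_constraint (g j) (\<xi> j) \<noteq> {}"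
  then obtain x where x: "x \<in> cone_constraint (g i) (\<xi> i)" "x \<in> cone_constraint (g j) (\<xi> j)"
    by blast
  then have "x \<bullet> x = 1"
    by (auto simp: cone_constraint_def norm_eq_1)
  then show False
    using separated[OF assms x] \<delta> cos_monotone_0_pi[of 0 "2 * \<delta>"] by simp
qed

lemma M_iff: "x \<in> M \<longleftrightarrow> norm x = 1 \<and> (\<forall>i\<in>{1..m}. x \<bullet> g i \<le> c i)"
  using dim by (intro free_space_iff norm_g \<xi> cones_disjoint) auto

lemma unsafe_compact: "compact (unsafe_set m g \<xi>)"
  unfolding unsafe_set_def by (intro compact_UN cone_constraint_compact) auto

lemma dilation_unsafe: "dilation \<epsilon> (unsafe_set m g \<xi>) = (\<Union>i\<in>{1..m}. dilation \<epsilon> (cone_constraint (g i) (\<xi> i)))"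
  and xd_notin_dilation: "xd \<notin> dilation \<epsilon> (unsafe_set m g \<xi>)"
proof -
  have "xd \<notin> dilation \<epsilon>bar (unsafe_set m g \<xi>)"
    using xd_far xd_in_M by (auto simp: nbhd_def free_space_def)
  then have not_le: "\<not> ds_set xd (unsafe_set m g \<xi>) \<le> \<epsilon>bar"
    using norm_xd by (auto simp: dilation_def)
  then show "xd \<notin> dilation \<epsilon> (unsafe_set m g \<xi>)"
    using \<epsilon> by (auto simp: dilation_def)
  show "dilation \<epsilon> (unsafe_set m g \<xi>) = (\<Union>i\<in>{1..m}. dilation \<epsilon> (cone_constraint (g i) (\<xi> i)))"
  proof (cases "m = 0")
    case True
    \<comment> \<open>Here \<open>ds_set x {}\<close> is an unspecified constant, which \<open>xd_far\<close> forces to exceed \<open>\<epsilon>\<close>.\<close>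
    then show ?thesis
      using not_le \<epsilon> by (auto simp: dilation_def unsafe_set_def ds_set_def)
  next
    case False
    have ne: "cone_constraint (g i) (\<xi> i) \<noteq> {}" if "i \<in> {1..m}" for i
      using cone_constraint_nonempty[OF norm_g[OF that]] by blast
    then have "unsafe_set m g \<xi> \<noteq> {}"
      using False by (auto simp: unsafe_set_def)
    note outer = dilation_iff[OF unsafe_compact this]
    show ?thesis
      unfolding set_eq_iff outer
      by (auto simp: dilation_iff[OF cone_constraint_compact ne] unsafe_set_def)
  qed
qed

text \<open>That a dilated cap has angular radius below \<open>pi\<close> is not assumed. It follows
  from the target: \<open>xd\<close> lies outside the dilated cap, at angle at most
  \<open>pi\<close> from \<open>g i\<close>.\<close>

lemma cap_angle:
  assumes "i \<in> {1..m}"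
  shows "\<xi> i + arccos (1 - \<epsilon>) < pi" "xd \<bullet> g i < e i"
proof -
  have bd: "0 \<le> arccos (xd \<bullet> g i)" "arccos (xd \<bullet> g i) \<le> pi" "cos (arccos (xd \<bullet> g i)) = xd \<bullet> g i"
    using inner_sphere_bounds[OF norm_xd norm_g[OF assms]] by (auto simp: arccos_lbound arccos_ubound)
  have "xd \<notin> dilation \<epsilon> (cone_constraint (g i) (\<xi> i))"
    using xd_notin_dilation dilation_unsafe assms by auto
  then have *: "\<xi> i + arccos (1 - \<epsilon>) < arccos (xd \<bullet> g i)"
    using dilation_cone_constraint_supset[of "g i" \<epsilon> "\<xi> i" xd] norm_g[OF assms] \<epsilon> \<epsilon>_less_1
      \<xi>[OF assms] dim norm_xd by force
  then show "\<xi> i + arccos (1 - \<epsilon>) < pi"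
    using bd by linarith
  have "cos (arccos (xd \<bullet> g i)) < e i"
    using * bd \<xi>[OF assms] arccos_\<epsilon> by (intro cos_monotone_0_pi) auto
  then show "xd \<bullet> g i < e i"
    by (simp only: bd)
qed

lemma cap_bounds:
  assumes "i \<in> {1..m}"
  shows "- 1 < e i" "e i < c i" "c i < 1"
proof -
  note * = cap_angle[OF assms] \<xi>[OF assms] arccos_\<epsilon>
  show "- 1 < e i"
    using cos_monotone_0_pi[of "\<xi> i + arccos (1 - \<epsilon>)" pi] * by simp
  show "e i < c i"
    using * by (intro cos_monotone_0_pi) auto
  show "c i < 1"
    using cos_monotone_0_pi[of 0 "\<xi> i"] * by simp
qed

lemma dilation_cone_iff:
  assumes "i \<in> {1..m}"
  shows "x \<in> dilation \<epsilon> (cone_constraint (g i) (\<xi> i)) \<longleftrightarrow> norm x = 1 \<and> e i \<le> x \<bullet> g i"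
proof (intro iffI conjI)
  assume "x \<in> dilation \<epsilon> (cone_constraint (g i) (\<xi> i))"
  then show "norm x = 1" "e i \<le> x \<bullet> g i"
    using dilation_cone_constraint_subset[of "g i" \<epsilon> "\<xi> i" x] norm_g[OF assms] \<epsilon> \<epsilon>_less_1 \<xi>[OF assms]
      cap_angle[OF assms] by auto
next
  assume x: "norm x = 1 \<and> e i \<le> x \<bullet> g i"
  have "arccos (x \<bullet> g i) \<le> arccos (e i)"
    using x inner_sphere_bounds[of x "g i"] norm_g[OF assms] by (intro arccos_le_arccos) auto
  also have "\<dots> = \<xi> i + arccos (1 - \<epsilon>)"
    using cap_angle[OF assms] \<xi>[OF assms] arccos_\<epsilon> by (intro arccos_cos) auto
  finally show "x \<in> dilation \<epsilon> (cone_constraint (g i) (\<xi> i))"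
    using dilation_cone_constraint_supset[of "g i" \<epsilon> "\<xi> i" x] norm_g[OF assms] \<epsilon> \<epsilon>_less_1
      \<xi>[OF assms] dim x by auto
qed

text \<open>Otherwise \<open>x\<close> would be within angle
  \<open>arccos (1 - \<epsilon>) < \<delta>\<close> of both constraints, which would then contain
  points at an angle below \<open>2 * \<delta>\<close>.\<close>

lemma caps_disjoint:
  assumes i: "i \<in> {1..m}" "norm x = 1" "e i \<le> x \<bullet> g i" and j: "j \<in> {1..m}" "e j \<le> x \<bullet> g j"
  shows "i = j"
proof (rule ccontr)
  assume "i \<noteq> j"
  have "\<exists>a\<in>cone_constraint (g i) (\<xi> i). 1 - \<epsilon> \<le> x \<bullet> a" if "i \<in> {1..m}" "e i \<le> x \<bullet> g i" for i
    using that dilation_cone_iff[OF that(1), of x] assms(2) cone_constraint_nonempty[OF norm_g[OF that(1)]]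
      dilation_iff[OF cone_constraint_compact] by blast
  then obtain a b where ab: "a \<in> cone_constraint (g i) (\<xi> i)" "b \<in> cone_constraint (g j) (\<xi> j)"
    "1 - \<epsilon> \<le> x \<bullet> a" "1 - \<epsilon> \<le> x \<bullet> b"
    using i j by meson
  let ?\<alpha> = "arccos (1 - \<epsilon>)"
  have "cos (?\<alpha> + ?\<alpha>) \<le> a \<bullet> b"
    using ab assms(2) arccos_\<epsilon> \<delta> \<epsilon> \<epsilon>_less_1
    by (intro arccos_triangle_sphere[of a x]) (auto simp: cone_constraint_def inner_commute)
  also have "\<dots> \<le> cos (2 * \<delta>)"
    using separated[OF i(1) j(1) \<open>i \<noteq> j\<close> ab(1,2)] .
  also have "\<dots> < cos (?\<alpha> + ?\<alpha>)"
    using arccos_\<epsilon> \<delta> by (intro cos_monotone_0_pi) auto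
  finally show False
    by simp
qed

text \<open>No point of \<open>M\<close> is interior to the unsafe set, so on \<open>M\<close>
  removing interiors has no effect and \<open>nbhd\<close> coincides with
  \<open>dilation\<close>.\<close>

lemma nbhd_iff:
  assumes "x \<in> M"
  shows "x \<in> nbhd \<epsilon> (unsafe_set m g \<xi>) \<longleftrightarrow> (\<exists>i\<in>{1..m}. e i \<le> x \<bullet> g i)"
    and "i \<in> {1..m} \<Longrightarrow> x \<in> nbhd \<epsilon> (cone_constraint (g i) (\<xi> i)) \<longleftrightarrow> e i \<le> x \<bullet> g i"
proof -
  have x: "norm x = 1" "x \<notin> sphere_interior (unsafe_set m g \<xi>)"
    using assms by (auto simp: free_space_def)
  then show "x \<in> nbhd \<epsilon> (unsafe_set m g \<xi>) \<longleftrightarrow> (\<exists>i\<in>{1..m}. e i \<le> x \<bullet> g i)"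
    by (auto simp: nbhd_def dilation_unsafe dilation_cone_iff)
  assume i: "i \<in> {1..m}"
  have "sphere_interior (cone_constraint (g i) (\<xi> i)) \<subseteq> sphere_interior (unsafe_set m g \<xi>)"
    unfolding sphere_interior_def using i by (intro interior_of_mono) (auto simp: unsafe_set_def)
  then show "x \<in> nbhd \<epsilon> (cone_constraint (g i) (\<xi> i)) \<longleftrightarrow> e i \<le> x \<bullet> g i"
    using x i by (auto simp: nbhd_def dilation_cone_iff)
qed

lemma active_index_eq:
  assumes "x \<in> M" "i \<in> {1..m}" "e i \<le> x \<bullet> g i"
  shows "active_index m \<epsilon> g \<xi> x = i"
  unfolding active_index_def
proof (rule the_equality)
  show "i \<in> {1..m} \<and> x \<in> nbhd \<epsilon> (cone_constraint (g i) (\<xi> i))"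
    using assms nbhd_iff(2) by auto
  show "j = i" if "j \<in> {1..m} \<and> x \<in> nbhd \<epsilon> (cone_constraint (g j) (\<xi> j))" for j
    using that assms nbhd_iff(2) caps_disjoint[of j x i] M_iff by auto
qed

text \<open>
  Extended by the constant \<open>1\<close>, each \<open>h i\<close> stays continuously differentiable because
  \<open>h' i\<close> vanishes at the right end point. On \<open>M\<close> at most one of the extensions differs from \<open>1\<close>,
  so sums over all constraints give formulas without case distinctions.
\<close>

definition "H i p = h i (min p (1 - e i))"
definition "H' i p = h' i (min p (1 - e i))"
definition "\<beta> x = 1 + (\<Sum>i\<in>{1..m}. H i (ds x (g i)) - 1)"
definition "\<gamma> x = (\<Sum>i\<in>{1..m}. H' i (ds x (g i)) *\<^sub>R g i)"

lemma h_domain_eq: "h_domain \<epsilon> (\<xi> i) = {1 - c i..1 - e i}"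
  by (simp add: h_domain_def)

lemma H_deriv:
  assumes i: "i \<in> {1..m}" and p: "1 - c i \<le> p"
  shows "(H i has_real_derivative H' i p) (at p within {1 - c i..})"
proof -
  have lh: "1 - c i < 1 - e i"
    using cap_bounds[OF i] by simp
  have left: "(H i has_real_derivative H' i p) (at p within {1 - c i..1 - e i})" if "p \<le> 1 - e i"
  proof (rule has_field_derivative_transform_within[where d = 1 and f = "h i"])
    show "(h i has_real_derivative H' i p) (at p within {1 - c i..1 - e i})"
      using h'[OF i, of p] that p by (simp add: h_domain_eq H'_def)
  qed (use that p in \<open>auto simp: H_def\<close>)
  have right: "(H i has_real_derivative H' i p) (at p within {1 - e i..})" if "1 - e i \<le> p"
  proof (rule has_field_derivative_transform_within[where d = 1 and f = "\<lambda>_. 1"])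
    show "((\<lambda>_. 1) has_real_derivative H' i p) (at p within {1 - e i..})"
      using h'_outer[OF i] that by (simp add: H'_def)
  qed (use that h_outer[OF i] in \<open>auto simp: H_def\<close>)
  consider "p < 1 - e i" | "p = 1 - e i" | "1 - e i < p"
    by linarith
  then show ?thesis
  proof cases
    case 1
    have "at p within {1 - c i..} = at p within {1 - c i..1 - e i}"
      by (rule at_within_nhd[where S = "{..<1 - e i}"]) (use 1 in auto)
    then show ?thesis
      using left 1 by simp
  next
    case 2
    have "{1 - c i..} = {1 - c i..1 - e i} \<union> {1 - e i..}"
      using lh by auto
    moreover have "(H i has_real_derivative H' i p) (at p within {1 - c i..1 - e i} \<union> {1 - e i..})"
      using left right 2 unfolding has_field_derivative_iff by (auto simp: at_within_union intro: filterlim_sup)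
    ultimately show ?thesis
      by simp
  next
    case 3
    have "at p within {1 - c i..} = at p within {1 - e i..}"
      by (rule at_within_nhd[where S = "{1 - e i<..}"]) (use 3 lh in auto)
    then show ?thesis
      using right 3 by simp
  qed
qed

text \<open>\<open>H i\<close> is \<open>h i\<close> after the nearest-point projection onto its
  domain, which is Lipschitz. Analyticity enters here: it makes \<open>h'' i\<close> continuous,
  hence bounded on the compact domain.\<close>

lemma is_lipschitz_on_H:
  assumes i: "i \<in> {1..m}"
  shows "is_lipschitz_on {1 - c i..} (H i)" "is_lipschitz_on {1 - c i..} (H' i)"
proof -
  let ?D = "{1 - c i..1 - e i}"
  have lh: "1 - c i < 1 - e i"
    using cap_bounds[OF i] by simp
  have "1-lipschitz_on {1 - c i..} (\<lambda>p. min p (1 - e i))"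
    by (intro lipschitz_onI) (auto simp: dist_real_def min_def)
  then have min: "is_lipschitz_on {1 - c i..} (\<lambda>p. min p (1 - e i))"
    unfolding is_lipschitz_on_def ..
  have dh: "(h i has_real_derivative h' i p) (at p within ?D)"
    and dh': "(h' i has_real_derivative h'' i p) (at p within ?D)" if "p \<in> ?D" for p
    using h'[OF i] h''[OF i] that by (auto simp: h_domain_eq)
  have "continuous_on ?D (h'' i)"
    using h_analytic[OF i] lh dh dh' unfolding h_domain_eq
    by (rule real_analytic_on_imp_second_derivative_continuous)
  then have "bounded (h'' i ` ?D)"
    by (intro compact_imp_bounded compact_continuous_image) auto
  then have lip': "is_lipschitz_on ?D (h' i)"
    by (intro is_lipschitz_on_vector_derivative[OF dh'[unfolded has_real_derivative_iff_has_vector_derivative]]) auto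
  then have "bounded (h' i ` ?D)"
    by (rule is_lipschitz_on_bounded) simp
  then have lip: "is_lipschitz_on ?D (h i)"
    by (intro is_lipschitz_on_vector_derivative[OF dh[unfolded has_real_derivative_iff_has_vector_derivative]]) auto
  have img: "(\<lambda>p. min p (1 - e i)) ` {1 - c i..} \<subseteq> ?D"
    using lh by (auto simp: min_def)
  show "is_lipschitz_on {1 - c i..} (H i)" "is_lipschitz_on {1 - c i..} (H' i)"
    unfolding H_def H'_def by (rule is_lipschitz_on_compose[OF min _ img], fact)+
qed

lemma compact_M: "compact M"
proof -
  have "M = sphere 0 1 \<inter> (\<Inter>i\<in>{1..m}. {x. x \<bullet> g i \<le> c i})"
    using M_iff by auto
  moreover have "closed (\<Inter>i\<in>{1..m}. {x. x \<bullet> g i \<le> c i})"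
    by (intro closed_INT ballI closed_Collect_le continuous_intros)
  ultimately show ?thesis
    by (simp add: compact_Int_closed)
qed

lemma norm_M: "x \<in> M \<Longrightarrow> norm x = 1"
  using M_iff by blast

lemma ds_M: "x \<in> M \<Longrightarrow> i \<in> {1..m} \<Longrightarrow> 1 - c i \<le> ds x (g i)"
  using M_iff by (auto simp: ds_def)

lemma near_eqs:
  assumes "x \<in> M" "i \<in> {1..m}" "e i \<le> x \<bullet> g i"
  shows "\<beta> x = h i (ds x (g i))" "\<gamma> x = h' i (ds x (g i)) *\<^sub>R g i"
    "u x = (k\<^sub>1 / (\<beta> x + ds x xd)\<^sup>2) *\<^sub>R (\<beta> x *\<^sub>R xd - ds x xd *\<^sub>R \<gamma> x)"
proof -
  have off: "H j (ds x (g j)) = 1" "H' j (ds x (g j)) = 0" if "j \<in> {1..m}" "j \<noteq> i" for j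
  proof -
    have "\<not> e j \<le> x \<bullet> g j"
      using caps_disjoint[OF assms(2) norm_M[OF assms(1)] assms(3) that(1)] that by auto
    then have "min (ds x (g j)) (1 - e j) = 1 - e j"
      by (simp add: ds_def min_def)
    then show "H j (ds x (g j)) = 1" "H' j (ds x (g j)) = 0"
      using h_outer[OF that(1)] h'_outer[OF that(1)] by (simp_all add: H_def H'_def)
  qed
  have on: "H i (ds x (g i)) = h i (ds x (g i))" "H' i (ds x (g i)) = h' i (ds x (g i))"
    using assms(3) by (auto simp: H_def H'_def ds_def min_def)
  have "(\<Sum>j\<in>{1..m}. H j (ds x (g j)) - 1) = H i (ds x (g i)) - 1"
    using off assms(2) by (subst sum.remove[of _ i]) auto
  then show \<beta>: "\<beta> x = h i (ds x (g i))"
    by (simp add: \<beta>_def on)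
  have "(\<Sum>j\<in>{1..m}. H' j (ds x (g j)) *\<^sub>R g j) = H' i (ds x (g i)) *\<^sub>R g i"
    using off assms(2) by (subst sum.remove[of _ i]) auto
  then show \<gamma>: "\<gamma> x = h' i (ds x (g i)) *\<^sub>R g i"
    by (simp add: \<gamma>_def on)
  have "x \<in> nbhd \<epsilon> (unsafe_set m g \<xi>)"
    using nbhd_iff(1)[OF assms(1)] assms by auto
  then show "u x = (k\<^sub>1 / (\<beta> x + ds x xd)\<^sup>2) *\<^sub>R (\<beta> x *\<^sub>R xd - ds x xd *\<^sub>R \<gamma> x)"
    unfolding \<beta> \<gamma> by (simp add: control_def active_index_eq[OF assms] Let_def mult.commute)
qed

lemma far_eqs:
  assumes "x \<in> M" "\<forall>i\<in>{1..m}. x \<bullet> g i \<le> e i"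
  shows "\<beta> x = 1" "\<gamma> x = 0" "u x = (k\<^sub>1 / (1 + ds x xd)\<^sup>2) *\<^sub>R xd"
proof -
  have "min (ds x (g i)) (1 - e i) = 1 - e i" if "i \<in> {1..m}" for i
    using assms(2) that by (simp add: ds_def min_absorb2)
  then show \<beta>: "\<beta> x = 1" and \<gamma>: "\<gamma> x = 0"
    using h_outer h'_outer by (simp_all add: \<beta>_def \<gamma>_def H_def H'_def)
  show "u x = (k\<^sub>1 / (1 + ds x xd)\<^sup>2) *\<^sub>R xd"
  \<comment> \<open>On the outer boundary \<open>x \<bullet> g i = e i\<close> the control uses its
    near branch; with \<open>\<beta> x = 1\<close> and \<open>\<gamma> x = 0\<close> both branches
    agree.\<close>
  proof (cases "\<exists>i\<in>{1..m}. e i \<le> x \<bullet> g i")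
    case True
    then obtain i where "i \<in> {1..m}" "e i \<le> x \<bullet> g i"
      by auto
    from near_eqs(3)[OF assms(1) this] show ?thesis
      by (simp add: \<beta> \<gamma>)
  next
    case False
    then show ?thesis
      using nbhd_iff(1)[OF assms(1)] by (simp add: control_def)
  qed
qed

lemma u_eq:
  assumes "x \<in> M"
  shows "u x = (k\<^sub>1 / (\<beta> x + ds x xd)\<^sup>2) *\<^sub>R (\<beta> x *\<^sub>R xd - ds x xd *\<^sub>R \<gamma> x)"
proof (cases "\<exists>i\<in>{1..m}. e i \<le> x \<bullet> g i")
  case True
  then show ?thesis
    using near_eqs(3)[OF assms] by auto
next
  case False
  then show ?thesis
    using far_eqs[OF assms] by (simp add: not_le less_imp_le)
qed

lemma \<beta>_range: "x \<in> M \<Longrightarrow> 0 \<le> \<beta> x \<and> \<beta> x \<le> 1"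
proof (cases "\<exists>i\<in>{1..m}. e i \<le> x \<bullet> g i")
  case True
  assume x: "x \<in> M"
  obtain i where i: "i \<in> {1..m}" "e i \<le> x \<bullet> g i"
    using True by auto
  have "ds x (g i) \<in> h_domain \<epsilon> (\<xi> i)"
    using i ds_M[OF x i(1)] by (auto simp: h_domain_eq ds_def)
  then show ?thesis
    using h_range[OF i(1)] near_eqs(1)[OF x i] by auto
next
  case False
  assume "x \<in> M"
  then show ?thesis
    using far_eqs[OF \<open>x \<in> M\<close>] False by (simp add: not_le less_imp_le)
qed

lemma ds_xd: "norm x = 1 \<Longrightarrow> 0 \<le> ds x xd \<and> ds x xd \<le> 2"
  using inner_sphere_bounds[OF _ norm_xd, of x] by (auto simp: ds_def)

lemma ds_xd_pos:
  assumes "norm x = 1" "x \<noteq> xd"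
  shows "0 < ds x xd"
proof -
  have "0 < (dist x xd)\<^sup>2"
    using assms(2) by simp
  then show ?thesis
    by (simp add: dist_sphere_eq_ds[OF assms(1) norm_xd])
qed

text \<open>The two nonnegative summands cannot vanish together: \<open>ds x xd\<close> is zero only
  at \<open>xd\<close>, which lies outside all layers, where \<open>\<beta>\<close> is
  \<open>1\<close>.\<close>

lemma denominator_pos: "x \<in> M \<Longrightarrow> 0 < \<beta> x + ds x xd"
proof (cases "x = xd")
  case True
  have "\<beta> xd = 1"
    using cap_angle(2) by (intro far_eqs xd_in_M) (auto intro: less_imp_le)
  then show ?thesis
    using True ds_xd[OF norm_xd] by simp
next
  case False
  assume "x \<in> M"
  then show ?thesis
    using ds_xd_pos[OF norm_M False] \<beta>_range by fastforce
qed

section \<open>Lipschitz continuity of the closed loop on \<open>M\<close>\<close>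

lemma bounded_M: "bounded M"
  using compact_M compact_imp_bounded by blast

lemma is_lipschitz_on_ds: "is_lipschitz_on S (\<lambda>x. ds x a)" if "bounded S"
  unfolding ds_def using that by (intro is_lipschitz_on_diff is_lipschitz_on_inner) auto

lemma is_lipschitz_on_H_ds:
  assumes "i \<in> {1..m}"
  shows "is_lipschitz_on M (\<lambda>x. H i (ds x (g i)))" "is_lipschitz_on M (\<lambda>x. H' i (ds x (g i)))"
  using is_lipschitz_on_compose[OF is_lipschitz_on_ds[OF bounded_M] is_lipschitz_on_H(1)[OF assms]]
    is_lipschitz_on_compose[OF is_lipschitz_on_ds[OF bounded_M] is_lipschitz_on_H(2)[OF assms]]
    ds_M assms by auto

lemma is_lipschitz_on_\<beta>_\<gamma>: "is_lipschitz_on M \<beta>" "is_lipschitz_on M \<gamma>"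
proof -
  show "is_lipschitz_on M \<beta>"
    unfolding \<beta>_def[abs_def]
    by (intro is_lipschitz_on_add is_lipschitz_on_const is_lipschitz_on_sum is_lipschitz_on_diff is_lipschitz_on_H_ds)
  show "is_lipschitz_on M \<gamma>"
    unfolding \<gamma>_def[abs_def]
    by (intro is_lipschitz_on_const is_lipschitz_on_sum is_lipschitz_on_scaleR is_lipschitz_on_H_ds bounded_M)
qed

lemma denominator_bounded_below: "\<exists>r>0. \<forall>x\<in>M. r \<le> \<beta> x + ds x xd"
proof -
  have "continuous_on M (\<lambda>x. \<beta> x + ds x xd)"
    using is_lipschitz_on_\<beta>_\<gamma>(1) is_lipschitz_on_ds[OF bounded_M]
    by (intro is_lipschitz_on_continuous_on is_lipschitz_on_add)
  from compact_pos_lower_bound[OF compact_M this denominator_pos] show ?thesis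
    by blast
qed

lemma is_lipschitz_on_u: "is_lipschitz_on M u"
proof -
  obtain r where r: "0 < r" "\<And>x. x \<in> M \<Longrightarrow> r \<le> \<beta> x + ds x xd"
    using denominator_bounded_below by auto
  have ds: "is_lipschitz_on M (\<lambda>x. ds x xd)"
    by (rule is_lipschitz_on_ds[OF bounded_M])
  have "is_lipschitz_on M (\<lambda>x. inverse ((\<beta> x + ds x xd) * (\<beta> x + ds x xd)))"
  proof (rule is_lipschitz_on_inverse)
    show "is_lipschitz_on M (\<lambda>x. (\<beta> x + ds x xd) * (\<beta> x + ds x xd))"
      by (intro is_lipschitz_on_mult is_lipschitz_on_add is_lipschitz_on_\<beta>_\<gamma> ds bounded_M)
    show "r * r \<le> (\<beta> x + ds x xd) * (\<beta> x + ds x xd)" if "x \<in> M" for x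
      using r(1) r(2)[OF that] by (intro mult_mono) auto
  qed (use r in auto)
  then have "is_lipschitz_on M (\<lambda>x. (k\<^sub>1 * inverse ((\<beta> x + ds x xd) * (\<beta> x + ds x xd)))
      *\<^sub>R (\<beta> x *\<^sub>R xd - ds x xd *\<^sub>R \<gamma> x))"
    by (intro is_lipschitz_on_scaleR is_lipschitz_on_mult is_lipschitz_on_diff is_lipschitz_on_const
        is_lipschitz_on_\<beta>_\<gamma> ds bounded_M)
  then show ?thesis
    by (rule is_lipschitz_on_cong[THEN iffD1, rotated]) (simp add: u_eq power2_eq_square divide_inverse)
qed

lemma is_lipschitz_on_f: "is_lipschitz_on M f"
  unfolding closed_loop_def[abs_def] tangent_proj_def
  by (intro is_lipschitz_on_diff is_lipschitz_on_scaleR is_lipschitz_on_inner is_lipschitz_on_u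
      is_lipschitz_on_ident bounded_M)

section \<open>Critical points and the boundary of \<open>M\<close>\<close>

lemma f_eq: "f x = u x - (x \<bullet> u x) *\<^sub>R x"
  by (simp add: closed_loop_def tangent_proj_def)

lemma f_tangent: "norm x = 1 \<Longrightarrow> x \<bullet> f x = 0"
  unfolding closed_loop_def by (rule norm_tangent_proj)

lemma inner_f_u: "norm x = 1 \<Longrightarrow> u x \<bullet> f x = (norm (f x))\<^sup>2"
  unfolding closed_loop_def by (simp add: norm_tangent_proj(1))

lemma tangent_proj_xd_eq_0:
  assumes "norm x = 1" "tangent_proj x xd = 0"
  shows "x = xd \<or> x = - xd"
proof -
  have xd_eq: "xd = (x \<bullet> xd) *\<^sub>R x"
    using assms(2) by (simp add: tangent_proj_def)
  then have "\<bar>x \<bullet> xd\<bar> = 1"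
    using norm_xd assms(1) by (metis norm_scaleR mult.right_neutral)
  then show ?thesis
    using xd_eq by (cases "x \<bullet> xd \<ge> 0") (auto simp: abs_if)
qed

lemma f_far:
  assumes "x \<in> M" "\<forall>i\<in>{1..m}. x \<bullet> g i \<le> e i"
  shows "f x = (k\<^sub>1 / (1 + ds x xd)\<^sup>2) *\<^sub>R tangent_proj x xd"
  by (simp add: closed_loop_def far_eqs[OF assms] tangent_proj_def algebra_simps)

lemma far_coeff_pos: "norm x = 1 \<Longrightarrow> 0 < k\<^sub>1 / (1 + ds x xd)\<^sup>2"
  using k\<^sub>1 ds_xd[of x] by (intro divide_pos_pos) auto

lemma f_far_eq_0:
  assumes "x \<in> M" "\<forall>i\<in>{1..m}. x \<bullet> g i \<le> e i" "f x = 0"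
  shows "x = xd \<or> x = - xd"
  using tangent_proj_xd_eq_0[OF norm_M[OF assms(1)]] f_far[OF assms(1,2)] assms(3)
    far_coeff_pos[OF norm_M[OF assms(1)]] by auto

text \<open>Here \<open>\<beta>\<close> vanishes, so only the repulsive term of \<open>u\<close> is left.\<close>

lemma boundary_inward:
  assumes "x \<in> M" "i \<in> {1..m}" "x \<bullet> g i = c i"
  shows "f x \<bullet> g i < 0"
proof -
  have near: "e i \<le> x \<bullet> g i"
    using cap_bounds[OF assms(2)] assms(3) by simp
  have "ds x (g i) = 1 - c i"
    using assms(3) by (simp add: ds_def)
  then have \<beta>: "\<beta> x = 0" and \<gamma>: "\<gamma> x = h' i (1 - c i) *\<^sub>R g i"
    using near_eqs[OF assms(1,2) near] h_inner[OF assms(2)] by auto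
  have "0 < h' i (1 - c i)"
    using h'_pos[OF assms(2)] cap_bounds[OF assms(2)] by simp
  moreover have d: "0 < ds x xd"
    using denominator_pos[OF assms(1)] \<beta> by simp
  moreover have "g i \<bullet> g i = 1"
    using norm_g[OF assms(2)] by (simp add: norm_eq_1)
  then have "f x \<bullet> g i = - (k\<^sub>1 / (ds x xd)\<^sup>2 * ds x xd * h' i (1 - c i) * (1 - (c i)\<^sup>2))"
    unfolding f_eq u_eq[OF assms(1)] \<beta> \<gamma>
    by (simp add: inner_diff_left inner_commute[of x] assms(3)[unfolded inner_commute[of x]]
        power2_eq_square algebra_simps)
  moreover have "(c i)\<^sup>2 < 1"
    using cap_bounds[OF assms(2)] by (simp add: abs_square_less_1)
  ultimately show ?thesis
    using k\<^sub>1 by simp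
qed

text \<open>
  If \<open>z \<bullet> u z\<close> were nonnegative at a critical point \<open>z\<close>, then \<open>xd\<close> would be a nonnegative combination
  of \<open>z\<close> and \<open>g i\<close>, hence would lie in the \<open>\<epsilon>\<close>-dilation of the constraint.
\<close>

lemma critical_radial_neg:
  assumes "z \<in> M" "f z = 0" "z \<noteq> xd"
  shows "z \<bullet> u z < 0"
proof (cases "\<exists>i\<in>{1..m}. e i \<le> z \<bullet> g i")
  case False
  then have far: "\<forall>i\<in>{1..m}. z \<bullet> g i \<le> e i"
    by (simp add: not_le less_imp_le)
  have "z = - xd"
    using f_far_eq_0[OF assms(1) far assms(2)] assms(3) by simp
  then have "z \<bullet> xd = - 1"
    using norm_xd by (simp add: norm_eq_1)
  then show ?thesis
    using far_coeff_pos[OF norm_M[OF assms(1)]] by (simp add: far_eqs(3)[OF assms(1) far])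
next
  case True
  then obtain i where i: "i \<in> {1..m}" "e i \<le> z \<bullet> g i"
    by auto
  have nz: "norm z = 1"
    using norm_M[OF assms(1)] .
  define p where "p = ds z (g i)"
  define C where "C = k\<^sub>1 / (\<beta> z + ds z xd)\<^sup>2"
  have "0 < C"
    using k\<^sub>1 denominator_pos[OF assms(1)] by (simp add: C_def)
  have p: "1 - c i \<le> p" "p \<le> 1 - e i"
    using ds_M[OF assms(1) i(1)] i(2) by (auto simp: p_def ds_def)
  \<comment> \<open>By strict monotonicity of \<open>h i\<close> a zero of \<open>\<beta>\<close> in
    the layer lies on the boundary of the constraint, where the field is not zero.\<close>
  have "\<beta> z \<noteq> 0"
  proof
    assume "\<beta> z = 0"
    then have "h i p = h i (1 - c i)"
      using near_eqs(1)[OF assms(1) i] h_inner[OF i(1)] by (simp add: p_def)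
    moreover have "strict_mono_on {1 - c i..1 - e i} (h i)"
      using h_mono[OF i(1)] by (simp add: h_domain_eq)
    ultimately have "p = 1 - c i"
      using p cap_bounds[OF i(1)] strict_mono_on_imp_inj_on[of "{1 - c i..1 - e i}" "h i"]
      by (auto dest: inj_onD)
    then show False
      using boundary_inward[OF assms(1) i(1)] assms(2) by (simp add: p_def ds_def)
  qed
  then have "0 < \<beta> z"
    using \<beta>_range[OF assms(1)] by auto
  have "0 \<le> h' i p"
    using h'_pos[OF i(1) p(1)] h'_outer[OF i(1)] p(2) by (cases "p = 1 - e i") auto
  have "0 \<le> ds z xd"
    using ds_xd[OF nz] by simp
  have u_z: "u z = (z \<bullet> u z) *\<^sub>R z"
    using assms(2) by (simp add: f_eq)
  show ?thesis
  proof (rule ccontr)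
    assume "\<not> z \<bullet> u z < 0"
    then have "0 \<le> z \<bullet> u z"
      by simp
    have uC: "C *\<^sub>R (\<beta> z *\<^sub>R xd - (ds z xd * h' i p) *\<^sub>R g i) = u z"
      using near_eqs(2,3)[OF assms(1) i] by (simp add: C_def p_def)
    have "C *\<^sub>R (\<beta> z *\<^sub>R xd - (ds z xd * h' i p) *\<^sub>R g i) = (z \<bullet> u z) *\<^sub>R z"
      unfolding uC by (rule u_z)
    then have eq: "(C * \<beta> z) *\<^sub>R xd = (z \<bullet> u z) *\<^sub>R z + (C * (ds z xd * h' i p)) *\<^sub>R g i"
      by (simp add: scaleR_diff_right algebra_simps)
    have "inverse (C * \<beta> z) * (C * \<beta> z) = 1"
      using \<open>0 < C\<close> \<open>0 < \<beta> z\<close> by (intro left_inverse) simp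
    then have "xd = inverse (C * \<beta> z) *\<^sub>R ((C * \<beta> z) *\<^sub>R xd)"
      by (simp only: scaleR_scaleR scaleR_one)
    also have "\<dots> = ((z \<bullet> u z) / (C * \<beta> z)) *\<^sub>R z + ((C * (ds z xd * h' i p)) / (C * \<beta> z)) *\<^sub>R g i"
      unfolding eq by (simp add: scaleR_add_right divide_inverse mult.commute)
    finally have "xd = \<dots>" .
    then have "z \<bullet> g i \<le> xd \<bullet> g i"
      using \<open>0 \<le> z \<bullet> u z\<close> \<open>0 < C\<close> \<open>0 < \<beta> z\<close> \<open>0 \<le> h' i p\<close> \<open>0 \<le> ds z xd\<close>
      by (intro inner_nonneg_combination_ge[OF nz norm_g[OF i(1)] norm_xd]) auto
    then show False
      using i(2) cap_angle(2)[OF i(1)] by simp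
  qed
qed


subsection \<open>Trajectories\<close>

text \<open>Only the field on \<open>M\<close> matters here: at the last time in \<open>M\<close> the field would point back into \<open>M\<close>.\<close>

lemma stays_in_M:
  assumes J: "is_interval J" "J \<subseteq> {0..}" "0 \<in> J" and "x 0 \<in> M"
    and nx: "\<And>t. t \<in> J \<Longrightarrow> norm (x t) = 1" and cont: "continuous_on J x"
    and deriv: "\<And>t. t \<in> J \<Longrightarrow> x t \<in> M \<Longrightarrow> (x has_vector_derivative f (x t)) (at t within J)"
    and "t\<^sub>1 \<in> J"
  shows "x t\<^sub>1 \<in> M"
proof (rule ccontr)
  assume out: "x t\<^sub>1 \<notin> M"
  have sub: "{0..t\<^sub>1} \<subseteq> J"
    using mem_is_interval_1_I[OF J(1,3) \<open>t\<^sub>1 \<in> J\<close>] by auto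
  define A where "A = {0..t\<^sub>1} \<inter> x -` M"
  have "closed A"
    unfolding A_def using continuous_on_subset[OF cont sub] compact_imp_closed[OF compact_M]
    by (intro continuous_closed_preimage) auto
  then have "compact A"
    by (auto simp: compact_eq_bounded_closed A_def intro: bounded_subset[of "{0..t\<^sub>1}"])
  moreover have "0 \<in> A"
    using J \<open>x 0 \<in> M\<close> \<open>t\<^sub>1 \<in> J\<close> by (auto simp: A_def)
  ultimately obtain s where s: "s \<in> A" "\<And>t. t \<in> A \<Longrightarrow> t \<le> s"
    using compact_attains_sup[of A] by blast
  have s': "s \<in> J" "x s \<in> M" "0 \<le> s" "s < t\<^sub>1"
    using s(1) sub out by (auto simp: A_def order_le_less)
  \<comment> \<open>Just after \<open>s\<close> no constraint is violated: the field pushes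
    \<open>x\<close> away from an active one, and an inactive one persists by continuity. Being
    finitely many, they hold together at some later time.\<close>
  have "\<forall>\<^sub>F t in at_right s. t \<in> J \<longrightarrow> x t \<bullet> g i \<le> c i" if i: "i \<in> {1..m}" for i
  proof (cases "x s \<bullet> g i = c i")
    case True
    have "((\<lambda>t. x t \<bullet> g i) has_real_derivative f (x s) \<bullet> g i) (at s within J)"
      by (rule has_vector_derivative_inner_right[OF deriv[OF s'(1,2)]])
    from has_real_derivative_neg_dec_right[OF this boundary_inward[OF s'(2) i True]]
    obtain d where d: "0 < d" "\<And>r. 0 < r \<Longrightarrow> s + r \<in> J \<Longrightarrow> r < d \<Longrightarrow> x (s + r) \<bullet> g i < x s \<bullet> g i"
      by blast
    have "x t \<bullet> g i \<le> c i" if "s < t" "t < s + d" "t \<in> J" for t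
      using d(2)[of "t - s"] that True by simp
    then show ?thesis
      using \<open>0 < d\<close> unfolding eventually_at_right_field by (intro exI[of _ "s + d"]) auto
  next
    case False
    moreover have "x s \<bullet> g i \<le> c i"
      using s'(2) i unfolding M_iff by blast
    ultimately have "x s \<bullet> g i < c i"
      by simp
    moreover have "((\<lambda>t. x t \<bullet> g i) \<longlongrightarrow> x s \<bullet> g i) (at s within {s..t\<^sub>1})"
    proof -
      have "continuous_on {s..t\<^sub>1} (\<lambda>t. x t \<bullet> g i)"
        using sub s'(3) by (intro continuous_intros continuous_on_subset[OF cont]) auto
      then show ?thesis
        using s'(4) by (simp add: continuous_on_def)
    qed
    ultimately have "\<forall>\<^sub>F t in at s within {s..t\<^sub>1}. x t \<bullet> g i < c i"
      by (intro order_tendstoD)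
    moreover have "at s within {s..t\<^sub>1} = at_right s"
      using s'(4) by (rule at_within_Icc_at_right)
    ultimately show ?thesis
      by (auto elim: eventually_mono)
  qed
  then have "\<forall>\<^sub>F t in at_right s. \<forall>i\<in>{1..m}. t \<in> J \<longrightarrow> x t \<bullet> g i \<le> c i"
    by (intro eventually_ball_finite) auto
  moreover have "\<forall>\<^sub>F t in at_right s. t \<in> {s<..<t\<^sub>1}"
    using s'(4) by (rule eventually_at_right_real)
  ultimately have "\<forall>\<^sub>F t in at_right s. (\<forall>i\<in>{1..m}. t \<in> J \<longrightarrow> x t \<bullet> g i \<le> c i) \<and> t \<in> {s<..<t\<^sub>1}"
    by (rule eventually_conj)
  then obtain t where t: "\<forall>i\<in>{1..m}. t \<in> J \<longrightarrow> x t \<bullet> g i \<le> c i" "s < t" "t < t\<^sub>1"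
    using eventually_happens'[OF trivial_limit_at_right_real] by force
  then have "t \<in> J"
    using sub s'(3) by auto
  then have "t \<in> A"
    using t nx s'(3) M_iff by (auto simp: A_def)
  then show False
    using s(2) t(2) by force
qed

definition trajectory :: "(real \<Rightarrow> 'a) \<Rightarrow> bool" where
  "trajectory x \<longleftrightarrow> (\<forall>t\<ge>0. x t \<in> M \<and> (x has_vector_derivative f (x t)) (at t within {0..}))"

lemma trajectoryD:
  assumes "trajectory x" "0 \<le> t"
  shows "x t \<in> M" "norm (x t) = 1" "(x has_vector_derivative f (x t)) (at t within {0..})"
  using assms norm_M by (auto simp: trajectory_def)

lemma solution_stays_in_M:
  assumes "is_interval J" "J \<subseteq> {0..}" "0 \<in> J" "solution_on f J x" "x 0 \<in> M" "t \<in> J"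
  shows "x t \<in> M"
proof (rule stays_in_M[of J x])
  show "continuous_on J x"
    using assms(4) unfolding solution_on_def continuous_on_eq_continuous_within
    by (auto intro: has_vector_derivative_continuous)
qed (use assms in \<open>auto simp: solution_on_def\<close>)

lemma trajectory_iff: "trajectory x \<longleftrightarrow> solution_on f {0..} x \<and> x 0 \<in> M"
proof
  assume "trajectory x"
  then show "solution_on f {0..} x \<and> x 0 \<in> M"
    by (auto simp: solution_on_def trajectoryD)
next
  assume sol: "solution_on f {0..} x \<and> x 0 \<in> M"
  have "x t \<in> M" if "0 \<le> t" for t
    by (rule solution_stays_in_M[of "{0..}"]) (use sol that in auto)
  then show "trajectory x"
    using sol by (auto simp: trajectory_def solution_on_def)
qed

text \<open>
  The field is extended from \<open>M\<close> to a globally Lipschitz field that is everywhere orthogonal to the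
  position vector, so that solutions keep their norm.
\<close>

lemma trajectory_exists:
  assumes "x\<^sub>0 \<in> M"
  shows "\<exists>x. trajectory x \<and> x 0 = x\<^sub>0"
proof -
  obtain F where F: "is_lipschitz_on UNIV F" "\<And>y. y \<in> M \<Longrightarrow> F y = f y"
    using is_lipschitz_on_extend[OF is_lipschitz_on_f] assms by blast
  let ?S = "sphere 0 1 :: 'a set"
  let ?E = "homogeneous_extension (\<lambda>y. tangent_proj y (F y))"
  have "is_lipschitz_on ?S (\<lambda>y. tangent_proj y (F y))"
    unfolding tangent_proj_def
    by (intro is_lipschitz_on_diff is_lipschitz_on_scaleR is_lipschitz_on_inner is_lipschitz_on_ident
        is_lipschitz_on_subset[OF F(1)]) auto
  then have "is_lipschitz_on {v. v = 0 \<or> sgn v \<in> ?S} ?E"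
    by (rule is_lipschitz_on_homogeneous_extension) simp
  moreover have "{v. v = 0 \<or> sgn v \<in> ?S} = UNIV"
    by (auto simp: norm_sgn)
  ultimately obtain x where x: "x 0 = x\<^sub>0"
    "\<And>t. 0 \<le> t \<Longrightarrow> (x has_vector_derivative ?E (x t)) (at t within {0..})"
    using lipschitz_ode_exists[of ?E x\<^sub>0] by auto
  have orth: "v \<bullet> ?E v = 0" for v
  proof (cases "v = 0")
    case False
    have "sgn v \<bullet> tangent_proj (sgn v) (F (sgn v)) = 0"
      using False by (intro norm_tangent_proj(3)) (simp add: norm_sgn)
    then show ?thesis
      using False by (simp add: homogeneous_extension_def sgn_div_norm)
  qed simp
  have nx: "norm (x t) = 1" if "0 \<le> t" for t
  proof -
    have "((\<lambda>t. x t \<bullet> x t) has_real_derivative 0) (at t within {0..})" if "0 \<le> t" for t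
      using has_vector_derivative_norm_square[OF x(2)[OF that]] by (simp add: orth)
    then obtain C where "\<And>t. t \<in> {0..} \<Longrightarrow> x t \<bullet> x t = C"
      using has_field_derivative_zero_constant[of "{0..}" "\<lambda>t. x t \<bullet> x t"] by auto
    then have "x t \<bullet> x t = x 0 \<bullet> x 0"
      using that by simp
    then show ?thesis
      using x(1) norm_M[OF assms] by (simp add: norm_eq_sqrt_inner)
  qed
  \<comment> \<open>On \<open>M\<close> the radial scaling is trivial and the field is already
    tangent, so neither modification changes it.\<close>
  have E: "?E y = f y" if "y \<in> M" for y
    using norm_M[OF that] F(2)[OF that] f_tangent[OF norm_M[OF that]]
    by (simp add: homogeneous_extension_def sgn_div_norm tangent_proj_def)
  have "x t \<in> M" if "0 \<le> t" for t
  proof (rule stays_in_M[of "{0..}" x])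
    show "continuous_on {0..} x"
      using x(2) unfolding continuous_on_eq_continuous_within
      by (auto intro: has_vector_derivative_continuous)
    show "(x has_vector_derivative f (x t)) (at t within {0..})" if "t \<in> {0..}" "x t \<in> M" for t
      using x(2)[of t] that E by simp
  qed (use x(1) assms nx that in auto)
  then have "trajectory x"
    using x(2) E by (auto simp: trajectory_def)
  then show ?thesis
    using x(1) by blast
qed

lemma forward_invariant_M: "forward_invariant f M"
  unfolding forward_invariant_def
proof (intro ballI conjI allI impI)
  fix x\<^sub>0 assume "x\<^sub>0 \<in> M"
  then show "\<exists>x. solution_on f {0..} x \<and> x 0 = x\<^sub>0"
    using trajectory_exists trajectory_iff by metis
  fix T x t assume "solution_on f {0..<T} x \<and> x 0 = x\<^sub>0" "t \<in> {0..<T}"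
  then show "x t \<in> M"
    by (intro solution_stays_in_M[of "{0..<T}" x t]) (use \<open>x\<^sub>0 \<in> M\<close> in auto)
qed

subsection \<open>The potential along trajectories\<close>

text \<open>This is \<open>nav_fun\<close> on \<open>M\<close>, with \<open>\<beta>\<close> in place
  of \<open>barrier\<close>, so that it can be differentiated along a trajectory even while that
  crosses the edge of a layer.\<close>

definition "potential x = k\<^sub>1 * ds x xd / (ds x xd + \<beta> x)"

lemma potential_deriv:
  assumes x: "trajectory x" and t: "0 \<le> t"
  shows "((\<lambda>t. potential (x t)) has_real_derivative - (norm (f (x t)))\<^sup>2) (at t within {0..})"
proof -
  note xt = trajectoryD[OF x t]
  let ?v = "f (x t)"
  have dds: "((\<lambda>t. ds (x t) a) has_real_derivative - (?v \<bullet> a)) (at t within {0..})" for a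
    unfolding ds_def using has_vector_derivative_inner_right[OF xt(3), of a]
    by (auto intro!: derivative_eq_intros)
  have dH: "((\<lambda>t. H i (ds (x t) (g i))) has_real_derivative H' i (ds (x t) (g i)) * - (?v \<bullet> g i))
      (at t within {0..})" if i: "i \<in> {1..m}" for i
  proof -
    have "(H i has_real_derivative H' i (ds (x t) (g i)))
        (at (ds (x t) (g i)) within (\<lambda>t. ds (x t) (g i)) ` {0..})"
      using ds_M[OF trajectoryD(1)[OF x] i] t
      by (intro has_field_derivative_subset[OF H_deriv[OF i]]) auto
    from DERIV_image_chain[OF this dds] show ?thesis
      by (simp add: o_def)
  qed
  have "((\<lambda>t. \<beta> (x t)) has_real_derivative (\<Sum>i\<in>{1..m}. H' i (ds (x t) (g i)) * - (?v \<bullet> g i))) (at t within {0..})"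
    unfolding \<beta>_def using dH by (auto intro!: derivative_eq_intros)
  also have "(\<Sum>i\<in>{1..m}. H' i (ds (x t) (g i)) * - (?v \<bullet> g i)) = - (?v \<bullet> \<gamma> (x t))"
    by (simp add: \<gamma>_def inner_sum_right sum_negf)
  finally have d\<beta>: "((\<lambda>t. \<beta> (x t)) has_real_derivative - (?v \<bullet> \<gamma> (x t))) (at t within {0..})" .
  have pos: "0 < ds (x t) xd + \<beta> (x t)"
    using denominator_pos[OF xt(1)] by simp
  let ?d = "ds (x t) xd" and ?b = "\<beta> (x t)"
  have "((\<lambda>t. potential (x t)) has_real_derivative
      (k\<^sub>1 * - (?v \<bullet> xd) * (?d + ?b) - k\<^sub>1 * ?d * (- (?v \<bullet> xd) + - (?v \<bullet> \<gamma> (x t)))) / ((?d + ?b) * (?d + ?b)))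
      (at t within {0..})"
    unfolding potential_def using pos
    by (intro DERIV_divide DERIV_cmult DERIV_add dds d\<beta>) auto
  also have "(k\<^sub>1 * - (?v \<bullet> xd) * (?d + ?b) - k\<^sub>1 * ?d * (- (?v \<bullet> xd) + - (?v \<bullet> \<gamma> (x t)))) / ((?d + ?b) * (?d + ?b))
      = - (u (x t) \<bullet> ?v)"
    unfolding u_eq[OF xt(1)]
    by (simp add: inner_diff_left inner_commute[of _ ?v] power2_eq_square add.commute[of ?b])
      (simp add: algebra_simps diff_divide_distrib add_divide_distrib)
  also have "u (x t) \<bullet> ?v = (norm ?v)\<^sup>2"
    by (rule inner_f_u[OF xt(2)])
  finally show ?thesis .
qed

lemma potential_nonneg: "x \<in> M \<Longrightarrow> 0 \<le> potential x"
  unfolding potential_def using k\<^sub>1 ds_xd[OF norm_M] denominator_pos[of x]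
  by (intro divide_nonneg_pos) (auto simp: add.commute)

lemma potential_decreasing:
  assumes "trajectory x" "0 \<le> s" "s \<le> t"
  shows "potential (x t) \<le> potential (x s)"
proof -
  have "- potential (x s) \<le> - potential (x t)"
  proof (rule mono_on_halfline[where a = 0 and f = "\<lambda>t. - potential (x t)" and f' = "\<lambda>t. (norm (f (x t)))\<^sup>2"])
    show "((\<lambda>t. - potential (x t)) has_real_derivative (norm (f (x r)))\<^sup>2) (at r within {0..})" if "0 \<le> r" for r
      using DERIV_minus[OF potential_deriv[OF assms(1) that]] by simp
  qed (use assms in auto)
  then show ?thesis
    by simp
qed

text \<open>The field is bounded on \<open>M\<close>, so \<open>x\<close> is Lipschitz in time, and
  so is its squared speed, the rate of decrease of the potential.\<close>

lemma eventually_slow: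
  assumes x: "trajectory x" and "0 < \<eta>"
  shows "\<forall>\<^sub>F t in at_top. norm (f (x t)) < \<eta>"
proof -
  have "bounded ((\<lambda>t. f (x t)) ` {0..})"
    by (rule bounded_subset[OF is_lipschitz_on_bounded[OF is_lipschitz_on_f bounded_M]])
      (use trajectoryD(1)[OF x] in auto)
  then have "is_lipschitz_on {0..} x"
    using trajectoryD(3)[OF x] by (intro is_lipschitz_on_vector_derivative[where f' = "\<lambda>t. f (x t)"]) auto
  moreover have "is_lipschitz_on M (\<lambda>y. (norm (f y))\<^sup>2)"
    unfolding power2_norm_eq_inner
    by (intro is_lipschitz_on_inner is_lipschitz_on_f bounded_M)
  ultimately have "is_lipschitz_on {0..} (\<lambda>t. (norm (f (x t)))\<^sup>2)"
    using trajectoryD(1)[OF x] by (rule_tac is_lipschitz_on_compose) auto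
  then have "((\<lambda>t. (norm (f (x t)))\<^sup>2) \<longlongrightarrow> 0) at_top"
    using potential_deriv[OF x] potential_nonneg trajectoryD(1)[OF x]
    by (intro decreasing_potential_imp_tendsto_0[of "\<lambda>t. potential (x t)"]) auto
  then have "((\<lambda>t. norm (f (x t))) \<longlongrightarrow> 0) at_top"
    by simp
  then show ?thesis
    using \<open>0 < \<eta>\<close> by (rule order_tendstoD(2))
qed

subsection \<open>Local behaviour at the target\<close>

lemma safe_radius:
  obtains r where "0 < r" "r \<le> 1"
    "\<And>x. norm x = 1 \<Longrightarrow> ds x xd < r \<Longrightarrow> \<forall>i\<in>{1..m}. x \<bullet> g i \<le> e i"
proof -
  define S where "S = (\<Inter>i\<in>{1..m}. {x. x \<bullet> g i < e i})"
  have "open S"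
    unfolding S_def by (intro open_INT ballI open_Collect_less continuous_intros) auto
  moreover have "xd \<in> S"
    using cap_angle(2) by (auto simp: S_def)
  ultimately obtain \<eta> where \<eta>: "0 < \<eta>" "ball xd \<eta> \<subseteq> S"
    by (auto simp: open_contains_ball)
  show ?thesis
  proof (rule that[of "min 1 (\<eta>\<^sup>2 / 2)"])
    fix x assume x: "norm x = 1" "ds x xd < min 1 (\<eta>\<^sup>2 / 2)"
    then have "(dist x xd)\<^sup>2 < \<eta>\<^sup>2"
      by (simp add: dist_sphere_eq_ds[OF _ norm_xd])
    then have "x \<in> ball xd \<eta>"
      using \<eta>(1) power2_less_imp_less[of "dist x xd" \<eta>] by (simp add: dist_commute)
    then show "\<forall>i\<in>{1..m}. x \<bullet> g i \<le> e i"
      using \<eta>(2) by (auto simp: S_def less_imp_le)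
  qed (use \<eta> in auto)
qed

text \<open>With \<open>d = ds x xd\<close>, the potential is at least
  \<open>k\<^sub>1 * d / (d + 1)\<close> because \<open>\<beta> \<le> 1\<close>, with equality at
  safe points, and this bound increases with \<open>d\<close>. Safety is therefore required at time
  \<open>s\<close> alone.\<close>

lemma ds_nonincreasing:
  assumes x: "trajectory x" and st: "0 \<le> s" "s \<le> t"
    and safe: "\<forall>i\<in>{1..m}. x s \<bullet> g i \<le> e i"
  shows "ds (x t) xd \<le> ds (x s) xd"
proof -
  have xt: "x t \<in> M" "norm (x t) = 1" and xs: "x s \<in> M" "norm (x s) = 1"
    using trajectoryD[OF x] st by auto
  have d0: "0 \<le> ds (x t) xd" "0 \<le> ds (x s) xd"
    using ds_xd xt xs by auto
  have "k\<^sub>1 * ds (x t) xd / (ds (x t) xd + 1) \<le> potential (x t)"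
    unfolding potential_def using \<beta>_range[OF xt(1)] denominator_pos[OF xt(1)] d0 k\<^sub>1
    by (intro divide_left_mono mult_pos_pos) (auto simp: add.commute)
  also have "\<dots> \<le> potential (x s)"
    by (rule potential_decreasing[OF x st])
  also have "\<dots> = k\<^sub>1 * ds (x s) xd / (ds (x s) xd + 1)"
    by (simp add: potential_def far_eqs(1)[OF xs(1) safe])
  finally show ?thesis
    using d0 k\<^sub>1 by (simp add: divide_simps algebra_simps)
qed

lemma stable: "stable_over f M xd"
  unfolding stable_over_def
proof (intro allI impI)
  fix \<eta> :: real assume "0 < \<eta>"
  obtain r where r: "0 < r" "r \<le> 1"
    "\<And>x. norm x = 1 \<Longrightarrow> ds x xd < r \<Longrightarrow> \<forall>i\<in>{1..m}. x \<bullet> g i \<le> e i"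
    using safe_radius by blast
  \<comment> \<open>Since \<open>(dist x xd)\<^sup>2 = 2 * ds x xd\<close>, the radius
    \<open>sqrt (2 * r)\<close> corresponds to \<open>ds x xd < r\<close>.\<close>
  define d where "d = min \<eta> (sqrt (2 * r))"
  show "\<exists>d>0. \<forall>x. solution_on f {0..} x \<and> x 0 \<in> M \<and> dist (x 0) xd < d \<longrightarrow> (\<forall>t\<ge>0. dist (x t) xd < \<eta>)"
  proof (intro exI[of _ d] conjI allI impI)
    show "0 < d"
      using r \<open>0 < \<eta>\<close> by (simp add: d_def)
    fix x and t :: real
    assume x: "solution_on f {0..} x \<and> x 0 \<in> M \<and> dist (x 0) xd < d" and t: "0 \<le> t"
    then have tr: "trajectory x"
      using trajectory_iff by blast
    note n = trajectoryD(2)[OF tr]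
    have "(dist (x 0) xd)\<^sup>2 < (sqrt (2 * r))\<^sup>2"
      using x by (intro power_strict_mono) (auto simp: d_def)
    then have "ds (x 0) xd < r"
      using r(1) by (simp add: dist_sphere_eq_ds[OF n norm_xd])
    then have "ds (x t) xd \<le> ds (x 0) xd"
      using r(3) n t by (intro ds_nonincreasing[OF tr]) auto
    then have "(dist (x t) xd)\<^sup>2 \<le> (dist (x 0) xd)\<^sup>2"
      using t by (simp add: dist_sphere_eq_ds[OF n norm_xd])
    then have "dist (x t) xd \<le> dist (x 0) xd"
      by (rule power2_le_imp_le) simp
    then show "dist (x t) xd < \<eta>"
      using x by (simp add: d_def)
  qed
qed

text \<open>Near the target the speed controls the distance: for \<open>d = ds x xd \<le> 1\<close>
  the squared norm of \<open>tangent_proj x xd\<close> is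
  \<open>d * (2 - d) \<ge> d\<close>.\<close>

lemma converges_if_close:
  assumes x: "trajectory x" and "0 \<le> s"
    and r: "r \<le> 1" "\<And>y. norm y = 1 \<Longrightarrow> ds y xd < r \<Longrightarrow> \<forall>i\<in>{1..m}. y \<bullet> g i \<le> e i"
    and close: "ds (x s) xd < r"
  shows "(x \<longlongrightarrow> xd) at_top"
proof (rule tendstoI)
  fix \<eta> :: real assume "0 < \<eta>"
  \<comment> \<open>As \<open>1 + d \<le> 2\<close>, the speed is at least
    \<open>k\<^sub>1 / 4\<close> times the norm of the tangential part of \<open>xd\<close>. That
    norm is thus below \<open>\<eta> / 2\<close>, which makes the squared distance less than
    \<open>2 * (\<eta> / 2)\<^sup>2\<close>.\<close>
  define \<eta>' where "\<eta>' = k\<^sub>1 / 4 * (\<eta> / 2)"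
  have "\<forall>\<^sub>F t in at_top. norm (f (x t)) < \<eta>'"
    using \<open>0 < \<eta>\<close> k\<^sub>1 by (intro eventually_slow[OF x]) (simp add: \<eta>'_def)
  moreover have "\<forall>\<^sub>F t in at_top. s \<le> t"
    by (rule eventually_ge_at_top)
  ultimately show "\<forall>\<^sub>F t in at_top. dist (x t) xd < \<eta>"
  proof eventually_elim
    case (elim t)
    have xt: "x t \<in> M" "norm (x t) = 1"
      using trajectoryD[OF x] \<open>0 \<le> s\<close> elim by auto
    have "ds (x t) xd \<le> ds (x s) xd"
      using r(2) close trajectoryD(2)[OF x] \<open>0 \<le> s\<close> elim by (intro ds_nonincreasing[OF x]) auto
    then have d: "ds (x t) xd < r" "0 \<le> ds (x t) xd" "ds (x t) xd \<le> 1"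
      using close ds_xd[OF xt(2)] r(1) by auto
    let ?d = "ds (x t) xd" and ?p = "tangent_proj (x t) xd"
    have "(norm ?p)\<^sup>2 = ?d * (2 - ?d)"
      using norm_tangent_proj(2)[OF xt(2), of xd] norm_xd
      by (simp add: ds_def power2_eq_square algebra_simps)
    also have "\<dots> \<ge> ?d * 1"
      using d by (intro mult_left_mono) auto
    finally have p: "?d \<le> (norm ?p)\<^sup>2"
      by simp
    have "(1 + ?d)\<^sup>2 \<le> 2\<^sup>2"
      using d by (intro power_mono) auto
    then have "k\<^sub>1 / 4 \<le> k\<^sub>1 / (1 + ?d)\<^sup>2"
      using k\<^sub>1 d by (intro divide_left_mono) auto
    then have "k\<^sub>1 / 4 * norm ?p \<le> k\<^sub>1 / (1 + ?d)\<^sup>2 * norm ?p"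
      by (intro mult_right_mono) auto
    also have "\<dots> = norm (f (x t))"
      using k\<^sub>1 by (simp add: f_far[OF xt(1) r(2)[OF xt(2) d(1)]])
    also have "\<dots> < k\<^sub>1 / 4 * (\<eta> / 2)"
      using elim by (simp add: \<eta>'_def)
    finally have "norm ?p < \<eta> / 2"
      using k\<^sub>1 by simp
    then have "(norm ?p)\<^sup>2 < (\<eta> / 2)\<^sup>2"
      by (intro power_strict_mono) auto
    then have "2 * ?d < 2 * (\<eta> / 2)\<^sup>2"
      using p by simp
    also have "\<dots> \<le> \<eta>\<^sup>2"
      by (simp add: power2_eq_square)
    finally have "(dist (x t) xd)\<^sup>2 < \<eta>\<^sup>2"
      by (simp add: dist_sphere_eq_ds[OF xt(2) norm_xd])
    then show "dist (x t) xd < \<eta>"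
      using \<open>0 < \<eta>\<close> by (auto intro: power2_less_imp_less)
  qed
qed


subsection \<open>Trajectories that miss the target\<close>

lemma \<gamma>_orthogonal:
  assumes "x \<in> M" "\<And>i. i \<in> {1..m} \<Longrightarrow> e i \<le> x \<bullet> g i \<Longrightarrow> g i \<bullet> w = 0"
  shows "\<gamma> x \<bullet> w = 0"
proof (cases "\<exists>i\<in>{1..m}. e i \<le> x \<bullet> g i")
  case True
  then obtain i where "i \<in> {1..m}" "e i \<le> x \<bullet> g i"
    by auto
  then show ?thesis
    using near_eqs(2)[OF assms(1)] assms(2) by simp
next
  case False
  then have "\<forall>i\<in>{1..m}. x \<bullet> g i \<le> e i"
    by (simp add: not_le less_imp_le)
  then show ?thesis
    using far_eqs(2)[OF assms(1)] by simp
qed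

text \<open>
  A crossing of the outer boundary of a cap not containing \<open>- xd\<close> happens at a speed bounded away
  from \<open>0\<close>, so an eventually slow trajectory stops crossing it.
\<close>

lemma eventually_inside_or_outside:
  assumes x: "trajectory x" and i: "i \<in> {1..m}" "- xd \<bullet> g i < e i"
  shows "(\<forall>\<^sub>F t in at_top. e i \<le> x t \<bullet> g i) \<or> (\<forall>\<^sub>F t in at_top. x t \<bullet> g i < e i)"
proof -
  define K where "K = M \<inter> {y. y \<bullet> g i = e i}"
  have "closed {y. y \<bullet> g i = e i}"
    by (intro closed_Collect_eq continuous_intros)
  then have "compact K"
    unfolding K_def using compact_M by (rule compact_Int_closed[rotated])
  moreover have "continuous_on K (\<lambda>y. norm (f y))"
    using is_lipschitz_on_continuous_on[OF is_lipschitz_on_f]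
    by (intro continuous_on_norm) (auto simp: K_def intro: continuous_on_subset)
  moreover have "0 < norm (f y)" if "y \<in> K" for y
  proof -
    have y: "y \<in> M" "y \<bullet> g i = e i"
      using that by (auto simp: K_def)
    \<comment> \<open>No other layer meets this one, so the field is the far one, which vanishes
      only at \<open>xd\<close> and \<open>- xd\<close>; neither lies on this boundary.\<close>
    have "y \<bullet> g j \<le> e j" if "j \<in> {1..m}" for j
      using caps_disjoint[OF i(1) norm_M[OF y(1)] _ that] y(2) by force
    then have "f y = 0 \<Longrightarrow> y = xd \<or> y = - xd"
      using f_far_eq_0[OF y(1)] by blast
    then show ?thesis
      using y(2) i(2) cap_angle(2)[OF i(1)] by auto
  qed
  ultimately obtain \<eta> where \<eta>: "0 < \<eta>" "\<And>y. y \<in> K \<Longrightarrow> \<eta> \<le> norm (f y)"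
    using compact_pos_lower_bound[of K "\<lambda>y. norm (f y)"] by blast
  have "\<forall>\<^sub>F t in at_top. norm (f (x t)) < \<eta> \<and> 0 \<le> t"
    using eventually_slow[OF x \<eta>(1)] eventually_ge_at_top by (rule eventually_conj)
  then obtain T where T: "\<And>t. T \<le> t \<Longrightarrow> norm (f (x t)) < \<eta> \<and> 0 \<le> t"
    by (auto simp: eventually_at_top_linorder)
  have ne: "x t \<bullet> g i \<noteq> e i" if "T \<le> t" for t
  proof
    assume "x t \<bullet> g i = e i"
    then have "x t \<in> K"
      using trajectoryD(1)[OF x] T[OF that] by (simp add: K_def)
    then show False
      using \<eta>(2) T[OF that] by force
  qed
  have "continuous_on {0..} x"
    using trajectoryD(3)[OF x] unfolding continuous_on_eq_continuous_within
    by (auto intro: has_vector_derivative_continuous)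
  then have "continuous_on {T..} (\<lambda>t. x t \<bullet> g i)"
    using T[of T] by (intro continuous_intros) (auto intro: continuous_on_subset)
  then have conn: "connected ((\<lambda>t. x t \<bullet> g i) ` {T..})"
    by (intro connected_continuous_image) auto
  have "(\<forall>t\<ge>T. e i \<le> x t \<bullet> g i) \<or> (\<forall>t\<ge>T. x t \<bullet> g i < e i)"
  proof (rule ccontr)
    assume "\<not> ?thesis"
    then obtain s t where "T \<le> s" "x s \<bullet> g i < e i" "T \<le> t" "e i \<le> x t \<bullet> g i"
      by force
    then have "e i \<in> (\<lambda>t. x t \<bullet> g i) ` {T..}"
      using connectedD_interval[OF conn, of "x s \<bullet> g i" "x t \<bullet> g i" "e i"] by auto
    then show False
      using ne by force
  qed
  then show ?thesis
    by (auto simp: eventually_at_top_linorder)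
qed

text \<open>If the trajectory eventually stays in one layer, disjointness gives \<open>a\<close>.
  Otherwise it eventually avoids each layer that does not contain \<open>- xd\<close>; at most one
  layer remains, whose centre is taken for \<open>a\<close>. If none remains, any choice such as
  \<open>xd\<close> will do.\<close>

lemma eventually_one_plane:
  assumes x: "trajectory x"
  shows "\<exists>a\<in>insert xd (g ` {1..m}).
    \<forall>\<^sub>F t in at_top. \<forall>i\<in>{1..m}. e i \<le> x t \<bullet> g i \<longrightarrow> g i = a"
proof (cases "\<exists>i\<in>{1..m}. \<forall>\<^sub>F t in at_top. e i \<le> x t \<bullet> g i")
  case True
  then obtain i where i: "i \<in> {1..m}" "\<forall>\<^sub>F t in at_top. e i \<le> x t \<bullet> g i"
    by blast
  from i(2) eventually_ge_at_top[of 0]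
  have "\<forall>\<^sub>F t in at_top. \<forall>j\<in>{1..m}. e j \<le> x t \<bullet> g j \<longrightarrow> g j = g i"
  proof eventually_elim
    case (elim t)
    then show ?case
      using caps_disjoint[OF i(1) trajectoryD(2)[OF x elim(2)] elim(1)] by blast
  qed
  then show ?thesis
    using i(1) by blast
next
  case False
  define I where "I = {i\<in>{1..m}. - xd \<bullet> g i < e i}"
  have "\<forall>\<^sub>F t in at_top. x t \<bullet> g i < e i" if "i \<in> I" for i
    using that eventually_inside_or_outside[OF x, of i] False by (auto simp: I_def)
  then have ev: "\<forall>\<^sub>F t in at_top. \<forall>i\<in>I. x t \<bullet> g i < e i"
    by (intro eventually_ball_finite) (auto simp: I_def)
  have "\<exists>a\<in>insert xd (g ` {1..m}). \<forall>i\<in>{1..m} - I. g i = a"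
  proof (cases "{1..m} \<subseteq> I")
    case True
    then show ?thesis
      by blast
  next
    case False
    then obtain j where j: "j \<in> {1..m}" "j \<notin> I"
      by blast
    then have "e j \<le> - xd \<bullet> g j"
      by (simp add: I_def not_less)
    then have "i = j" if "i \<in> {1..m} - I" for i
      using caps_disjoint[of i "- xd" j] that j(1) norm_xd by (auto simp: I_def)
    then show ?thesis
      using j(1) by blast
  qed
  then obtain a where a: "a \<in> insert xd (g ` {1..m})" "\<And>i. i \<in> {1..m} - I \<Longrightarrow> g i = a"
    by blast
  from ev have "\<forall>\<^sub>F t in at_top. \<forall>i\<in>{1..m}. e i \<le> x t \<bullet> g i \<longrightarrow> g i = a"
    by (rule eventually_mono) (use a(2) in \<open>force simp: not_le\<close>)
  then show ?thesis
    using a(1) by blast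
qed

text \<open>The speed and the negative part of \<open>y \<bullet> u y\<close> cannot both vanish
  away from \<open>xd\<close>, so by compactness their sum has a positive lower bound. If the speed
  is below half of it, the other summand exceeds the other half.\<close>

lemma radial_bound:
  assumes "0 < r"
  shows "\<exists>C>0. \<forall>y\<in>M. r \<le> ds y xd \<longrightarrow> norm (f y) < C \<longrightarrow> y \<bullet> u y < - C"
proof -
  define K where "K = M \<inter> {y. r \<le> ds y xd}"
  have "closed {y. r \<le> ds y xd}"
    unfolding ds_def by (intro closed_Collect_le continuous_intros)
  then have "compact K"
    unfolding K_def using compact_M by (rule compact_Int_closed[rotated])
  moreover have "continuous_on K (\<lambda>y. norm (f y) + max 0 (- (y \<bullet> u y)))"
    using is_lipschitz_on_continuous_on[OF is_lipschitz_on_f]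
      is_lipschitz_on_continuous_on[OF is_lipschitz_on_u]
    by (intro continuous_intros) (auto simp: K_def intro: continuous_on_subset)
  moreover have "0 < norm (f y) + max 0 (- (y \<bullet> u y))" if "y \<in> K" for y
  proof (cases "f y = 0")
    case True
    have "y \<noteq> xd"
      using that assms norm_xd by (auto simp: K_def ds_def norm_eq_1)
    then show ?thesis
      using critical_radial_neg[of y] that True by (simp add: K_def)
  qed (simp add: add_pos_nonneg)
  ultimately obtain C where C: "0 < C" "\<And>y. y \<in> K \<Longrightarrow> C \<le> norm (f y) + max 0 (- (y \<bullet> u y))"
    using compact_pos_lower_bound[of K "\<lambda>y. norm (f y) + max 0 (- (y \<bullet> u y))"] by blast
  have "y \<bullet> u y < - (C / 2)" if "y \<in> M" "r \<le> ds y xd" "norm (f y) < C / 2" for y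
    using C(2)[of y] that C(1) by (auto simp: K_def max_def split: if_splits)
  then show ?thesis
    using C(1) by (intro exI[of _ "C / 2"]) auto
qed

text \<open>
  For \<open>w\<close> orthogonal to the plane of \<open>u\<close>, the component \<open>x t \<bullet> w\<close> grows because \<open>x t \<bullet> u\<close> is negative,
  and at the same time it is controlled by the vanishing speed; hence it is zero.
\<close>

lemma hits_hyperplane:
  assumes x: "trajectory x" and nonconv: "\<not> (x \<longlongrightarrow> xd) at_top"
  shows "\<exists>a\<in>insert xd (g ` {1..m}). \<forall>w. w \<bullet> xd = 0 \<longrightarrow> w \<bullet> a = 0 \<longrightarrow> (\<exists>N::nat. x (real N) \<bullet> w = 0)"
proof -
  obtain r where r: "0 < r" "r \<le> 1"
    "\<And>y. norm y = 1 \<Longrightarrow> ds y xd < r \<Longrightarrow> \<forall>i\<in>{1..m}. y \<bullet> g i \<le> e i"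
    using safe_radius by blast
  have avoid: "r \<le> ds (x t) xd" if "0 \<le> t" for t
    using converges_if_close[OF x that r(2,3)] nonconv by (meson not_le)
  obtain a where a: "a \<in> insert xd (g ` {1..m})"
    "\<forall>\<^sub>F t in at_top. \<forall>i\<in>{1..m}. e i \<le> x t \<bullet> g i \<longrightarrow> g i = a"
    using eventually_one_plane[OF x] by blast
  obtain C where C: "0 < C" "\<And>y. y \<in> M \<Longrightarrow> r \<le> ds y xd \<Longrightarrow> norm (f y) < C \<Longrightarrow> y \<bullet> u y < - C"
    using radial_bound[OF r(1)] by blast
  have "\<forall>\<^sub>F t in at_top. 0 \<le> t \<and> norm (f (x t)) < C \<and> (\<forall>i\<in>{1..m}. e i \<le> x t \<bullet> g i \<longrightarrow> g i = a)"
    using a(2) eventually_slow[OF x C(1)] by (intro eventually_conj eventually_ge_at_top)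
  then obtain T where T: "\<And>t. T \<le> t \<Longrightarrow>
      0 \<le> t \<and> norm (f (x t)) < C \<and> (\<forall>i\<in>{1..m}. e i \<le> x t \<bullet> g i \<longrightarrow> g i = a)"
    by (auto simp: eventually_at_top_linorder)
  have "x s \<bullet> w = 0" if "T \<le> s" and w: "w \<bullet> xd = 0" "w \<bullet> a = 0" for s w
  proof (rule ccontr)
    assume "x s \<bullet> w \<noteq> 0"
    have xt: "0 \<le> t" "x t \<in> M" "norm (x t) = 1" if "s \<le> t" for t
      using T[of t] that \<open>T \<le> s\<close> trajectoryD[OF x, of t] by auto
    have rad: "x t \<bullet> u (x t) < - C" if "s \<le> t" for t
      using C(2)[OF xt(2)[OF that] avoid] xt(1)[OF that] T[of t] that \<open>T \<le> s\<close> by auto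
    have fw: "f (x t) \<bullet> w = - (x t \<bullet> u (x t)) * (x t \<bullet> w)" if "s \<le> t" for t
    proof -
      have "\<gamma> (x t) \<bullet> w = 0"
        using T[of t] that \<open>T \<le> s\<close> w(2)
        by (intro \<gamma>_orthogonal[OF xt(2)[OF that]]) (auto simp: inner_commute)
      then have "u (x t) \<bullet> w = 0"
        using w(1) by (simp add: u_eq[OF xt(2)[OF that]] inner_diff_left inner_diff_right inner_commute[of _ w])
      then show ?thesis
        by (simp add: f_eq inner_diff_left)
    qed
    have grow: "(x s \<bullet> w)\<^sup>2 \<le> (x t \<bullet> w)\<^sup>2" if "s \<le> t" for t
    proof (rule mono_on_halfline[where a = s and f = "\<lambda>t. (x t \<bullet> w)\<^sup>2" and f' = "\<lambda>t. 2 * (x t \<bullet> w) * (f (x t) \<bullet> w)"])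
      show "((\<lambda>t. (x t \<bullet> w)\<^sup>2) has_real_derivative 2 * (x r \<bullet> w) * (f (x r) \<bullet> w)) (at r within {s..})"
        if "s \<le> r" for r
      proof -
        have "((\<lambda>t. x t \<bullet> w) has_real_derivative f (x r) \<bullet> w) (at r within {s..})"
          using has_vector_derivative_inner_right[OF trajectoryD(3)[OF x xt(1)[OF that]]]
          by (rule has_field_derivative_subset) (use xt(1)[of s] in auto)
        from DERIV_power[OF this, of 2] show ?thesis
          by (simp add: mult_ac)
      qed
      show "0 \<le> 2 * (x r \<bullet> w) * (f (x r) \<bullet> w)" if "s \<le> r" for r
      proof -
        have "2 * (x r \<bullet> w) * (f (x r) \<bullet> w) = 2 * (- (x r \<bullet> u (x r))) * (x r \<bullet> w)\<^sup>2"
          by (simp add: fw[OF that] power2_eq_square)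
        also have "\<dots> \<ge> 0"
          using rad[OF that] C(1) by (intro mult_nonneg_nonneg) auto
        finally show ?thesis .
      qed
    qed (use that in auto)
    define b where "b = \<bar>x s \<bullet> w\<bar>"
    have "0 < b"
      using \<open>x s \<bullet> w \<noteq> 0\<close> by (simp add: b_def)
    have "w \<noteq> 0"
      using \<open>x s \<bullet> w \<noteq> 0\<close> by auto
    \<comment> \<open>At this speed the Cauchy-Schwarz inequality puts
      \<open>\<bar>f (x t) \<bullet> w\<bar>\<close> below \<open>C * b\<close>, which
      \<open>grow\<close> and \<open>rad\<close> forbid.\<close>
    have "\<forall>\<^sub>F t in at_top. norm (f (x t)) < C * b / norm w"
      using \<open>0 < b\<close> C(1) \<open>w \<noteq> 0\<close> by (intro eventually_slow[OF x]) auto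
    then have "\<forall>\<^sub>F t in at_top. norm (f (x t)) < C * b / norm w \<and> s \<le> t"
      using eventually_ge_at_top by (rule eventually_conj)
    then obtain t where t: "norm (f (x t)) < C * b / norm w" "s \<le> t"
      using eventually_happens'[OF trivial_limit_at_top_linorder] by blast
    have "b \<le> \<bar>x t \<bullet> w\<bar>"
      using grow[OF t(2)] by (simp add: b_def abs_le_square_iff)
    then have "C * b \<le> - (x t \<bullet> u (x t)) * \<bar>x t \<bullet> w\<bar>"
      using rad[OF t(2)] C(1) \<open>0 < b\<close> by (intro mult_mono) auto
    also have "\<dots> = \<bar>f (x t) \<bullet> w\<bar>"
      using rad[OF t(2)] C(1) by (simp add: fw[OF t(2)] abs_mult)
    also have "\<dots> \<le> norm (f (x t)) * norm w"
      by (rule Cauchy_Schwarz_ineq2)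
    also have "\<dots> < C * b"
      using t(1) \<open>w \<noteq> 0\<close> by (simp add: pos_less_divide_eq)
    finally show False
      by simp
  qed
  moreover obtain N :: nat where "T \<le> real N"
    using real_arch_simple by blast
  ultimately show ?thesis
    using a(1) by blast
qed

text \<open>
  The flow for time \<open>N\<close> has a Lipschitz inverse, so the points that reach a hyperplane at time \<open>N\<close>
  form a null set.
\<close>

lemma sphere_null_hits_hyperplane:
  assumes "w \<noteq> 0" "0 \<le> T"
  shows "sphere_null {x 0 | x. trajectory x \<and> x T \<bullet> w = 0}"
proof -
  define E where "E = {x T | x. trajectory x \<and> x T \<bullet> w = 0}"
  \<comment> \<open>The inverse of the flow for time \<open>T\<close>. The choice is harmless: by
    \<open>gron\<close>, trajectories that meet at time \<open>T\<close> have the same initial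
    point.\<close>
  define \<psi> where "\<psi> y = (SOME x. trajectory x \<and> x T = y) 0" for y
  obtain L where L: "L-lipschitz_on M f"
    using is_lipschitz_on_f is_lipschitz_on_def by blast
  have gron: "dist (x 0) (y 0) \<le> exp (L * T) * dist (x T) (y T)" if "trajectory x" "trajectory y" for x y
    using that \<open>0 \<le> T\<close> trajectoryD by (intro backward_gronwall[OF L]) auto
  have some: "trajectory (SOME z. trajectory z \<and> z T = x T) \<and> (SOME z. trajectory z \<and> z T = x T) T = x T"
    if "trajectory x" for x
    using that by (intro someI[of "\<lambda>z. trajectory z \<and> z T = x T" x]) auto
  have \<psi>: "\<psi> (x T) = x 0" if "trajectory x" for x
    using gron[OF that some[THEN conjunct1, OF that]] some[THEN conjunct2, OF that] by (simp add: \<psi>_def)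
  have "sphere_null (\<psi> ` E)"
  \<comment> \<open>The hyperplane passes through the origin, so it contains the whole ray through
    each point of \<open>E\<close>.\<close>
  proof (rule sphere_null_is_lipschitz_on_image[where N = "{v. w \<bullet> v = 0}"])
    have "(exp (L * T))-lipschitz_on E \<psi>"
      by (intro lipschitz_onI) (auto simp: E_def \<psi> gron)
    then show "is_lipschitz_on E \<psi>"
      unfolding is_lipschitz_on_def ..
    show "E \<subseteq> sphere 0 1" "\<psi> ` E \<subseteq> sphere 0 1"
      using trajectoryD(2) \<open>0 \<le> T\<close> by (auto simp: E_def \<psi>)
    show "negligible {v. w \<bullet> v = 0}"
      using assms(1) by (intro negligible_hyperplane) auto
  qed (auto simp: E_def inner_commute)
  moreover have "\<psi> ` E = {x 0 | x. trajectory x \<and> x T \<bullet> w = 0}"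
    by (auto simp: E_def \<psi> image_iff) (metis \<psi>)+
  ultimately show ?thesis
    by simp
qed

lemma sphere_null_not_attracted: "sphere_null {x\<^sub>0 \<in> M. \<not> attracted_from f xd x\<^sub>0}"
proof -
  \<comment> \<open>\<open>xd\<close> and \<open>a\<close> span at most a plane, and the ambient
    dimension is at least 3.\<close>
  have "\<exists>w. w \<noteq> 0 \<and> w \<bullet> xd = 0 \<and> w \<bullet> a = 0" for a :: 'a
  proof -
    have "dim {xd, a} \<le> card {xd, a}"
      by (rule dim_le_card') simp
    also have "\<dots> < DIM('a)"
      using dim card_insert_le_m1[of 2 "{a}" xd] by (auto simp: card_insert_if)
    finally obtain w where "w \<noteq> 0" "\<And>y. y \<in> span {xd, a} \<Longrightarrow> orthogonal w y"
      using orthogonal_to_subspace_exists by blast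
    then show ?thesis
      by (intro exI[of _ w]) (auto simp: orthogonal_def span_base)
  qed
  then obtain w where w: "\<And>a. w a \<noteq> 0 \<and> w a \<bullet> xd = 0 \<and> w a \<bullet> a = 0"
    by metis
  let ?B = "\<Union>a\<in>insert xd (g ` {1..m}). \<Union>N. {x 0 | x. trajectory x \<and> x (real N) \<bullet> w a = 0}"
  have "sphere_null (\<Union>N. {x 0 | x. trajectory x \<and> x (real N) \<bullet> w a = 0})" for a
    using w by (intro sphere_null_UN sphere_null_hits_hyperplane) auto
  then have "sphere_null ?B"
    by (rule sphere_null_UN[rotated]) (auto intro: countable_finite)
  moreover have "{x\<^sub>0 \<in> M. \<not> attracted_from f xd x\<^sub>0} \<subseteq> ?B"
  proof
    fix x\<^sub>0 assume x0: "x\<^sub>0 \<in> {x\<^sub>0 \<in> M. \<not> attracted_from f xd x\<^sub>0}"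
    \<comment> \<open>As a solution always exists, not being attracted means that some solution
      fails to converge.\<close>
    then have "\<exists>x. solution_on f {0..} x \<and> x 0 = x\<^sub>0"
      using trajectory_exists trajectory_iff by blast
    then obtain x where x: "solution_on f {0..} x" "x 0 = x\<^sub>0" "\<not> (x \<longlongrightarrow> xd) at_top"
      using x0 unfolding attracted_from_def by blast
    then have tr: "trajectory x"
      using x0 trajectory_iff by simp
    obtain a where a: "a \<in> insert xd (g ` {1..m})" "\<exists>N::nat. x (real N) \<bullet> w a = 0"
      using hits_hyperplane[OF tr x(3)] w by blast
    then show "x\<^sub>0 \<in> ?B"
      using tr x(2) by blast
  qed
  ultimately show ?thesis
    by (rule sphere_null_subset)
qed

end

theorem theorem1:
  fixes n m :: nat
    and g :: "nat \<Rightarrow> 'a::euclidean_space" and xd :: 'a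
    and \<xi> :: "nat \<Rightarrow> real"
    and h h' h'' :: "nat \<Rightarrow> real \<Rightarrow> real"
    and \<delta> \<epsilon> \<epsilon>bar k\<^sub>1 :: real
  assumes "n \<ge> 2" and "DIM('a) = n + 1"
    and "\<And>i. i \<in> {1..m} \<Longrightarrow> g i \<in> sphere 0 1 - {xd}"
    and "\<And>i. i \<in> {1..m} \<Longrightarrow> 0 < \<xi> i \<and> \<xi> i < pi"
    and "xd \<in> sphere_interior (free_space m g \<xi>)"
    and "0 < \<delta>" and "\<delta> \<le> pi / 2"
    and "\<And>i j a b. \<lbrakk>i \<in> {1..m}; j \<in> {1..m}; i \<noteq> j;
            a \<in> cone_constraint (g i) (\<xi> i); b \<in> cone_constraint (g j) (\<xi> j)\<rbrakk>
          \<Longrightarrow> a \<bullet> b \<le> cos (2 * \<delta>)"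
    and "\<epsilon>bar > 0" and "xd \<notin> nbhd \<epsilon>bar (unsafe_set m g \<xi>)"
    and "0 < \<epsilon>" and "\<epsilon> < min \<epsilon>bar (1 - cos \<delta>)"
    and "\<And>i. i \<in> {1..m} \<Longrightarrow> h i \<in> h_domain \<epsilon> (\<xi> i) \<rightarrow> {0..1}"
    and "\<And>i. i \<in> {1..m} \<Longrightarrow> strict_mono_on (h_domain \<epsilon> (\<xi> i)) (h i)"
    and "\<And>i. i \<in> {1..m} \<Longrightarrow> real_analytic_on (h i) (h_domain \<epsilon> (\<xi> i))"
    and "\<And>i p. \<lbrakk>i \<in> {1..m}; p \<in> h_domain \<epsilon> (\<xi> i)\<rbrakk>
          \<Longrightarrow> (h i has_real_derivative h' i p) (at p within h_domain \<epsilon> (\<xi> i))"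
    and "\<And>i p. \<lbrakk>i \<in> {1..m}; p \<in> h_domain \<epsilon> (\<xi> i)\<rbrakk>
          \<Longrightarrow> (h' i has_real_derivative h'' i p) (at p within h_domain \<epsilon> (\<xi> i))"
    and "\<And>i. i \<in> {1..m} \<Longrightarrow> h i (1 - cos (\<xi> i)) = 0"
    and "\<And>i. i \<in> {1..m} \<Longrightarrow> h i (1 - cos (\<xi> i + arccos (1 - \<epsilon>))) = 1"
    and "\<And>i. i \<in> {1..m} \<Longrightarrow> h' i (1 - cos (\<xi> i + arccos (1 - \<epsilon>))) = 0"
    and "\<And>i. i \<in> {1..m} \<Longrightarrow> h'' i (1 - cos (\<xi> i + arccos (1 - \<epsilon>))) = 0"
    and "\<And>i p. \<lbrakk>i \<in> {1..m}; 1 - cos (\<xi> i) \<le> p; p < 1 - cos (\<xi> i + arccos (1 - \<epsilon>))\<rbrakk>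
          \<Longrightarrow> h' i p > 0"
    and "k\<^sub>1 > 0"
  shows "forward_invariant (closed_loop (control m \<epsilon> k\<^sub>1 xd g \<xi> h h')) (free_space m g \<xi>)
       \<and> almost_globally_asymptotically_stable (closed_loop (control m \<epsilon> k\<^sub>1 xd g \<xi> h h'))
           (free_space m g \<xi>) xd"
proof -
  interpret conic_navigation m g xd \<xi> h h' h'' \<delta> \<epsilon> \<epsilon>bar k\<^sub>1
  proof unfold_locales
    show "3 \<le> DIM('a)"
      using assms(1,2) by simp
  qed (fact assms)+
  show ?thesis
    unfolding almost_globally_asymptotically_stable_def
    using forward_invariant_M stable sphere_null_not_attracted by blast
qed

end
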